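(* Let $G \subset \mathbf{SU}(2,1)$ be a non-elementary complex hyperbolic Kleinian group (that is, a non-elementary discrete subgroup of $\mathbf{SU}(2,1)$). If the trace $\mathrm{tr}(g)$ of every element $g \in G$ is real, then $G$ is Fuchsian, i.e. $G$ is either $\mathbf{C}$-Fuchsian ($G$ keeps invariant some complex line in $\mathbf{H}^2_{\mathbf{C}}$) or $\mathbf{R}$-Fuchsian ($G$ keeps invariant some Lagrangian plane in $\mathbf{H}^2_{\mathbf{C}}$).
   Context: Let $\mathbf{C}^{2,1}$ be $\mathbf{C}^3$ equipped with the Hermitian form of signature $(2,1)$ $$\langle \mathbf{z},\mathbf{w}\rangle = z_1\overline{w_3}+z_2\overline{w_2}+z_3\overline{w_1}.$$ Let $V_-=\{\mathbf{z}\in\mathbf{C}^{2,1} : \langle \mathbf{z},\mathbf{z}\rangle<0\}$ and $V_0=\{\mathbf{z}\in\mathbf{C}^{2,1} : \langle \mathbf{z},\mathbf{z}\rangle=0\}$, and let $\mathbf{P}:\mathbf{C}^3\setminus\{0\}\to\mathbf{C}\mathbf{P}^2$ be the canonical projection. Complex hyperbolic space is $\mathbf{H}^2_{\mathbf{C}}=\mathbf{P}(V_-)$, its boundary is $\partial\mathbf{H}^2_{\mathbf{C}}=\mathbf{P}(V_0\setminus\{0\})$, and $\overline{\mathbf{H}^2_{\mathbf{C}}}=\mathbf{H}^2_{\mathbf{C}}\cup\partial\mathbf{H}^2_{\mathbf{C}}$. In the non-homogeneous coordinates $(z_1,z_2)\leftrightarrow \mathbf{P}\big((z_1,z_2,1)^t\big)$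 one has $\mathbf{H}^2_{\mathbf{C}}=\{(z_1,z_2)\in\mathbf{C}^2 : 2\,\mathrm{Re}(z_1)+|z_2|^2<0\}$. $\mathbf{SU}(2,1)$ is the group of complex $3\times 3$ matrices of determinant $1$ that preserve $\langle\cdot,\cdot\rangle$. It acts on $\mathbf{H}^2_{\mathbf{C}}$ and on $\partial\mathbf{H}^2_{\mathbf{C}}$ by projective transformations. A complex (hyperbolic) Kleinian group is a discrete subgroup of $\mathbf{SU}(2,1)$. A subgroup $G\subset\mathbf{SU}(2,1)$ is elementary if it has a finite $G$-orbit in $\overline{\mathbf{H}^2_{\mathbf{C}}}$; otherwise it is non-elementary. A complex line is the image under some element of $\mathbf{SU}(2,1)$ of $L_1=\{(z_1,z_2)\in\mathbf{H}^2_{\mathbf{C}} : z_2=0\}$. A Lagrangian plane is the image under some element of $\mathbf{SU}(2,1)$ of $L_{\mathbf{R}}=\{(z_1,z_2)\in\mathbf{H}^2_{\mathbf{C}} : \mathrm{Im}(z_1)=\mathrm{Im}(z_2)=0\}$. A group $G$ keeps a subset $S\subset\mathbf{H}^2_{\mathbf{C}}$ invariant if $g(S)=S$ for all $g\in G$. A complex Kleinian group $G\subset\mathbf{SU}(2,1)$ is $\mathbf{R}$-Fuchsian (respectively $\mathbf{C}$-Fuchsian) if it keeps invariant some Lagrangian plane (respectively some complex line). $G$ is Fuchsian if it is $\mathbf{C}$-Fuchsian or $\mathbf{R}$-Fuchsian. *)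

theory Defs
  imports "HOL-Analysis.Analysis" "HOL-Algebra.Group"
begin

section \<open>The Hermitian form of signature (2,1)\<close>

definition herm :: "complex^3 \<Rightarrow> complex^3 \<Rightarrow> complex" where
  "herm z w = z$1 * cnj (w$3) + z$2 * cnj (w$2) + z$3 * cnj (w$1)"

lemma herm_self_real: "Im (herm z z) = 0"
  by (simp add: herm_def)

text \<open>Since \<open>herm z z\<close> is always real, negativity is a condition on its real part.\<close>

definition V_neg :: "(complex^3) set" where
  "V_neg = {z. Re (herm z z) < 0}"

definition V_null :: "(complex^3) set" where
  "V_null = {z. herm z z = 0}"

section \<open>Complex hyperbolic plane\<close>

text \<open>A point of the complex projective plane is a one-dimensional complex subspace of
  \<open>complex^3\<close>. The value \<open>proj2 0\<close> is not a point and is never used.\<close>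

definition proj2 :: "complex^3 \<Rightarrow> (complex^3) set" where
  "proj2 z = range (\<lambda>c. c *s z)"

lemma proj2_eq_iff:
  assumes "z \<noteq> 0" "w \<noteq> 0"
  shows "proj2 z = proj2 w \<longleftrightarrow> (\<exists>c. c \<noteq> 0 \<and> w = c *s z)"
proof
  assume "proj2 z = proj2 w"
  moreover have "w \<in> proj2 w" unfolding proj2_def by (metis rangeI vector_smult_lid)
  ultimately obtain c where "w = c *s z" unfolding proj2_def by auto
  with assms show "\<exists>c. c \<noteq> 0 \<and> w = c *s z" by auto
next
  assume "\<exists>c. c \<noteq> 0 \<and> w = c *s z"
  then obtain c where c: "c \<noteq> 0" "w = c *s z" by auto
  have "a *s z = (a / c) *s w" for a using c by simp
  moreover have "a *s w = (a * c) *s z" for a using c by simp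
  ultimately show "proj2 z = proj2 w" unfolding proj2_def by blast
qed

definition H2C :: "(complex^3) set set" where
  "H2C = proj2 ` V_neg"

definition bdry_H2C :: "(complex^3) set set" where
  "bdry_H2C = proj2 ` (V_null - {0})"

definition closed_H2C :: "(complex^3) set set" where
  "closed_H2C = H2C \<union> bdry_H2C"

definition affine_pt :: "complex \<Rightarrow> complex \<Rightarrow> (complex^3) set" where
  "affine_pt z1 z2 = proj2 (vector [z1, z2, 1])"

lemma affine_pt_in_H2C_iff:
  "affine_pt z1 z2 \<in> H2C \<longleftrightarrow> 2 * Re z1 + (cmod z2)\<^sup>2 < 0"
proof -
  let ?v = "vector [z1, z2, 1] :: complex^3"
  have v: "Re (herm ?v ?v) = 2 * Re z1 + (cmod z2)\<^sup>2"
    by (simp add: herm_def cmod_power2) (simp add: power2_eq_square)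
  have scale: "herm (c *s z) (c *s z) = of_real ((cmod c)\<^sup>2) * herm z z" for c z
    using complex_norm_square[of c] by (simp add: herm_def algebra_simps)
  have "affine_pt z1 z2 \<in> H2C \<longleftrightarrow> ?v \<in> V_neg"
  proof
    assume "?v \<in> V_neg"
    then show "affine_pt z1 z2 \<in> H2C" by (auto simp: affine_pt_def H2C_def)
  next
    assume "affine_pt z1 z2 \<in> H2C"
    then obtain w where w: "w \<in> V_neg" "proj2 ?v = proj2 w"
      by (auto simp: affine_pt_def H2C_def)
    have "?v \<noteq> 0" by (metis vector_3(3) zero_index zero_neq_one)
    moreover have "w \<noteq> 0" using w(1) by (auto simp: V_neg_def herm_def)
    ultimately obtain c where "w = c *s ?v" "c \<noteq> 0"
      using w(2) proj2_eq_iff by blast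
    with w(1) scale[of c ?v] show "?v \<in> V_neg"
      by (auto simp: V_neg_def mult_less_0_iff not_less[symmetric])
  qed
  with v show ?thesis by (simp add: V_neg_def)
qed

section \<open>The group SU(2,1) and its action\<close>

definition SU21 :: "(complex^3^3) monoid" where
  "SU21 = \<lparr> carrier = {A. det A = 1 \<and> (\<forall>z w. herm (A *v z) (A *v w) = herm z w)},
            monoid.mult = (\<lambda>A B. A ** B),
            one = mat 1 \<rparr>"

lemma group_SU21: "group SU21"
proof (rule groupI)
  fix A assume A: "A \<in> carrier SU21"
  then have "invertible A" by (simp add: SU21_def invertible_det_nz)
  then obtain B where B: "A ** B = mat 1" "B ** A = mat 1"
    unfolding invertible_def by auto
  have "det B = 1"
    using A B(2) det_mul[of B A] by (simp add: SU21_def)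
  moreover have "herm (B *v z) (B *v w) = herm z w" for z w
  proof -
    have "herm (A *v (B *v z)) (A *v (B *v w)) = herm (B *v z) (B *v w)"
      using A by (simp add: SU21_def)
    then show ?thesis using B(1) by (simp add: matrix_vector_mul_assoc)
  qed
  ultimately show "\<exists>B\<in>carrier SU21. B \<otimes>\<^bsub>SU21\<^esub> A = \<one>\<^bsub>SU21\<^esub>"
    using B(2) by (auto simp: SU21_def)
qed (simp_all add: SU21_def det_mul matrix_mul_assoc flip: matrix_vector_mul_assoc)

definition act :: "complex^3^3 \<Rightarrow> (complex^3) set \<Rightarrow> (complex^3) set" where
  "act A p = (\<lambda>v. A *v v) ` p"

lemma act_proj2: "act A (proj2 z) = proj2 (A *v z)"
  by (simp add: act_def proj2_def image_image vec.scale)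

section \<open>Complex Kleinian and Fuchsian groups\<close>

text \<open>Discreteness refers to the topology inherited from the entrywise topology on
  \<open>complex^3^3\<close>.\<close>

definition complex_kleinian :: "(complex^3^3) set \<Rightarrow> bool" where
  "complex_kleinian G \<longleftrightarrow> subgroup G SU21 \<and> discrete G"

definition elementary :: "(complex^3^3) set \<Rightarrow> bool" where
  "elementary G \<longleftrightarrow> (\<exists>p\<in>closed_H2C. finite ((\<lambda>g. act g p) ` G))"

definition std_complex_line :: "(complex^3) set set" where
  "std_complex_line = {affine_pt z1 z2 | z1 z2. affine_pt z1 z2 \<in> H2C \<and> z2 = 0}"

definition std_Lagrangian_plane :: "(complex^3) set set" where
  "std_Lagrangian_plane =
     {affine_pt z1 z2 | z1 z2. affine_pt z1 z2 \<in> H2C \<and> Im z1 = 0 \<and> Im z2 = 0}"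

definition complex_line :: "(complex^3) set set \<Rightarrow> bool" where
  "complex_line S \<longleftrightarrow> (\<exists>A\<in>carrier SU21. S = act A ` std_complex_line)"

definition Lagrangian_plane :: "(complex^3) set set \<Rightarrow> bool" where
  "Lagrangian_plane S \<longleftrightarrow> (\<exists>A\<in>carrier SU21. S = act A ` std_Lagrangian_plane)"

definition keeps_invariant :: "(complex^3^3) set \<Rightarrow> (complex^3) set set \<Rightarrow> bool" where
  "keeps_invariant G S \<longleftrightarrow> (\<forall>g\<in>G. act g ` S = S)"

definition C_Fuchsian :: "(complex^3^3) set \<Rightarrow> bool" where
  "C_Fuchsian G \<longleftrightarrow> complex_kleinian G \<and> (\<exists>S. complex_line S \<and> keeps_invariant G S)"

definition R_Fuchsian :: "(complex^3^3) set \<Rightarrow> bool" where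
  "R_Fuchsian G \<longleftrightarrow> complex_kleinian G \<and> (\<exists>S. Lagrangian_plane S \<and> keeps_invariant G S)"

definition Fuchsian :: "(complex^3^3) set \<Rightarrow> bool" where
  "Fuchsian G \<longleftrightarrow> C_Fuchsian G \<or> R_Fuchsian G"

end

(*
If G fixes a complex line C v of C^3, then v cannot be negative or null, as G is non-elementary;
so v is positive and G preserves the complex line orthogonal to v.

Otherwise G is irreducible and spans M_3(C) by Burnside's theorem. Since the traces are real and the
trace form is nondegenerate, the real span R of G is a real form of M_3(C), and X + iY |-> X - iY
(X, Y in R) is an antilinear ring automorphism fixing G. Applying it to matrices with one nonzero
column gives an antilinear map J of C^3 commuting with G. By Schur's lemma J^2 is a scalar, which is
real, and positive because the dimension is odd; so J^2 = 1 after rescaling. Again by Schur's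
lemma, J preserves the Hermitian form up to sign and conjugation, and the signature excludes the
minus sign. The fixed points of J form the invariant Lagrangian plane.
*)

theory Submission
  imports Defs "HOL-Computational_Algebra.Fundamental_Theorem_Algebra"
begin

section \<open>Eigenvectors and annihilators\<close>

text \<open>Excluding invariant lines also excludes invariant planes: the
  \<open>herm\<close>-orthogonal complement of an invariant plane is an invariant line. The traces
  act as follows: if X + iY = 0 with X, Y in R, then tr(XZ) + i tr(YZ) = 0 for every Z in R with
  both traces real, so both vanish, and nondegeneracy gives X = Y = 0. The matrix conjugation lives
  on M_3(C), not on C^3; matrices supported in one column form a left ideal on which G acts as it
  does on C^3, which is why that ideal carries the conjugation over. For the sign, the conjugate of
  <Jx, Jy> is again sesquilinear in x, y and G-invariant, hence equal to c <x, y>, and J^2 = 1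
  forces c^2 = 1; c = -1 would turn a positive definite plane into a negative definite one.\<close>

lemma complex_cubic_splits:
  fixes t s d :: complex
  obtains a b c where "t = a + b + c" "s = a * b + a * c + b * c" "d = a * b * c"
proof -
  have "\<exists>z. poly [:- d, s, - t, 1:] z = 0"
    by (rule fundamental_theorem_of_algebra_alt) auto
  then obtain a where a: "a * (a * (a - t) + s) = d"
    by (auto simp: algebra_simps)
  define r where "r = csqrt ((t - a)\<^sup>2 - 4 * (a\<^sup>2 - t * a + s))"
  have r: "r * r = (t - a)\<^sup>2 - 4 * (a\<^sup>2 - t * a + s)"
    unfolding r_def by (metis power2_csqrt power2_eq_square)
  define b c where "b = (t - a + r) / 2" and "c = (t - a - r) / 2"
  have bc: "b + c = t - a"
    by (simp add: b_def c_def field_simps)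
  have "b * c = ((t - a)\<^sup>2 - r * r) / 4"
    by (simp add: b_def c_def field_simps power2_eq_square)
  then have "4 * (b * c) = 4 * (a\<^sup>2 - t * a + s)"
    unfolding r by (simp add: field_simps)
  then have bc': "b * c = a\<^sup>2 - t * a + s"
    by (simp only: mult_cancel_left) simp
  show thesis
  proof
    show "t = a + b + c" using bc by (simp add: algebra_simps)
    have "a * b + a * c + b * c = a * (b + c) + b * c" by (simp add: algebra_simps)
    then show "s = a * b + a * c + b * c"
      unfolding bc bc' by (simp add: algebra_simps power2_eq_square)
    have "a * b * c = a * (b * c)" by simp
    then show "d = a * b * c" using a unfolding bc' by (simp add: algebra_simps power2_eq_square)
  qed
qed

text \<open>\<open>s\<close> is the sum of the principal 2 by 2 minors, the linear coefficient of
  the characteristic polynomial.\<close>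

lemma cayley_hamilton_3:
  fixes M :: "'a::comm_ring_1^3^3"
  defines "s \<equiv> M$1$1 * M$2$2 - M$1$2 * M$2$1 + M$1$1 * M$3$3 - M$1$3 * M$3$1
    + M$2$2 * M$3$3 - M$2$3 * M$3$2"
  shows "M *v (M *v (M *v v)) - trace M *s (M *v (M *v v)) + s *s (M *v v) - det M *s v = 0"
  unfolding s_def
  by (simp add: vec_eq_iff forall_3 matrix_vector_mult_def sum_3 trace_def det_3 algebra_simps)

text \<open>By Cayley-Hamilton, (M - c)(M - b)(M - a) kills \<open>w0\<close>. The last nonzero
  vector in the chain \<open>w0\<close>, \<open>w1\<close>, \<open>w2\<close> is an eigenvector, and
  the closure condition keeps the chain inside \<open>W\<close>.\<close>

lemma eigenvector_in_invariant_set: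
  fixes M :: "complex^3^3"
  assumes inv: "\<And>w c. w \<in> W \<Longrightarrow> M *v w - c *s w \<in> W"
    and "w0 \<in> W" "w0 \<noteq> 0"
  obtains w c where "w \<in> W" "w \<noteq> 0" "M *v w = c *s w"
proof -
  obtain s where ch: "M *v (M *v (M *v w0)) - trace M *s (M *v (M *v w0)) + s *s (M *v w0) 
      - det M *s w0 = 0"
    using cayley_hamilton_3 by blast
  obtain a b c where abc: "trace M = a + b + c" "s = a * b + a * c + b * c" "det M = a * b * c"
    by (rule complex_cubic_splits)
  define w1 where "w1 = M *v w0 - a *s w0"
  define w2 where "w2 = M *v w1 - b *s w1"
  have "M *v w2 - c *s w2 = 0"
    using ch unfolding w2_def w1_def abc
    by (simp add: algebra_simps vec.scale vec.add vec.diff)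
  moreover have "w1 \<in> W" "w2 \<in> W"
    unfolding w1_def w2_def by (intro inv assms(2))+
  ultimately show thesis
    using that[of w0 a] that[of w1 b] that[of w2 c] assms(2,3) w1_def w2_def by fastforce
qed

text \<open>A real orthogonal vector makes the real part of the sum vanish on \<open>W\<close>;
  testing \<open>\<i> *s w\<close> as well kills the imaginary part.\<close>

lemma proper_subspace_annihilator:
  fixes W :: "(complex^'n) set"
  assumes W: "vec.subspace W" "W \<noteq> UNIV"
  obtains u where "u \<noteq> 0" "\<And>w. w \<in> W \<Longrightarrow> (\<Sum>i\<in>UNIV. u$i * w$i) = 0"
proof -
  have sc: "c *\<^sub>R w = complex_of_real c *s w" for c and w :: "complex^'n"
    unfolding vec_eq_iff by (simp add: scaleR_conv_of_real[where 'a=complex])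
  have "subspace W"
    using W(1) by (simp add: vec.subspace_def subspace_def sc)
  then have "span W \<subset> span UNIV"
    using W(2) by (metis psubsetI span_UNIV span_eq_iff top_greatest)
  then obtain x where x: "x \<noteq> 0" "\<And>w. w \<in> W \<Longrightarrow> x \<bullet> w = 0"
    using orthogonal_to_subspace_exists_gen[of W UNIV]
    unfolding orthogonal_def by (metis span_base)
  define u where "u = (\<chi> i. cnj (x$i))"
  have re: "Re (\<Sum>i\<in>UNIV. u$i * w$i) = x \<bullet> w" for w
    by (simp add: u_def inner_vec_def inner_complex_def)
  show thesis
  proof
    show "u \<noteq> 0" using x(1) by (auto simp: u_def vec_eq_iff)
    fix w assume w: "w \<in> W"
    then have "\<i> *s w \<in> W" using W(1) by (simp add: vec.subspace_def)
    moreover have "(\<Sum>i\<in>UNIV. u$i * (\<i> *s w)$i) = \<i> * (\<Sum>i\<in>UNIV. u$i * w$i)"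
      by (simp add: sum_distrib_left algebra_simps)
    ultimately show "(\<Sum>i\<in>UNIV. u$i * w$i) = 0"
      using x(2)[OF w] x(2) re[of w] re[of "\<i> *s w"] by (simp add: complex_eq_iff)
  qed
qed

section \<open>Burnside's theorem for 3 by 3 matrices\<close>

definition outer :: "complex^3 \<Rightarrow> complex^3 \<Rightarrow> complex^3^3" where
  "outer u f = (\<chi> i j. u$i * f$j)"

lemma outer_mult_left: "S ** outer u f = outer (S *v u) f"
  by (simp add: outer_def vec_eq_iff matrix_matrix_mult_def matrix_vector_mult_def
      sum_distrib_right mult.assoc)

lemma outer_mult_right: "outer u f ** S = outer u (f v* S)"
  by (simp add: outer_def vec_eq_iff matrix_matrix_mult_def vector_matrix_mult_def
      sum_distrib_left mult_ac)

lemma mat_mult_vec [simp]: "mat c *v (v :: complex^3) = c *s v"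
  by (simp add: vec_eq_iff forall_3 matrix_vector_mult_def mat_def sum_3)

lemma mat_mult_mult_vec: "(mat c ** (X :: complex^3^3)) *v v = c *s (X *v v)"
  by (simp flip: matrix_vector_mul_assoc)

lemma mat_mult_right: "X ** mat c = mat c ** (X :: complex^3^3)"
  by (simp add: matrix_eq mat_mult_mult_vec vec.scale flip: matrix_vector_mul_assoc)

lemma vec_mult_mat_mult: "(f :: complex^3) v* (mat c ** X) = c *s (f v* X)"
  by (simp add: vec_eq_iff forall_3 vector_matrix_mult_def matrix_matrix_mult_def mat_def sum_3 
      algebra_simps)

text \<open>Complex scalars act through the scalar matrices \<open>mat c\<close>, since the vector
  space structure that \<open>span\<close> sees on \<open>complex^3^3\<close> is the real
  one.\<close>

definition matrix_algebra :: "(complex^3^3) set \<Rightarrow> bool" where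
  "matrix_algebra A \<longleftrightarrow> mat 1 \<in> A \<and> (\<forall>X\<in>A. \<forall>Y\<in>A. X + Y \<in> A \<and> X ** Y \<in> A) \<and>
     (\<forall>c. \<forall>X\<in>A. mat c ** X \<in> A)"

text \<open>For a matrix algebra this is irreducibility: the vectors \<open>S *v x\<close> with S in
  A form the smallest invariant subspace containing x.\<close>

definition transitive_on_vectors :: "(complex^3^3) set \<Rightarrow> bool" where
  "transitive_on_vectors A \<longleftrightarrow> (\<forall>x y. x \<noteq> 0 \<longrightarrow> (\<exists>S\<in>A. S *v x = y))"

lemma matrix_algebra_shift:
  assumes "matrix_algebra A" "X \<in> A" "Y \<in> A"
  shows "X - mat c ** Y \<in> A"
proof -
  have "- (mat c ** Y) = mat (- c) ** Y"
    by (simp add: matrix_matrix_mult_def mat_def vec_eq_iff forall_3 sum_3)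
  then have "X - mat c ** Y = X + mat (- c) ** Y"
    by (metis diff_conv_add_uminus)
  moreover have "X + mat (- c) ** Y \<in> A"
    using assms by (simp add: matrix_algebra_def)
  ultimately show ?thesis by metis
qed

text \<open>Take \<open>T \<noteq> 0\<close> with kernel of maximal dimension. If \<open>u = T x\<close> and \<open>T y\<close> were independent,
  then for \<open>S u = y\<close> and \<open>c\<close> an eigenvalue of \<open>T S\<close> on the range of \<open>T\<close>, the matrix
  \<open>T S T - c T\<close> would be nonzero with a larger kernel.\<close>

lemma transitive_algebra_rank_one:
  assumes A: "matrix_algebra A" and tr: "transitive_on_vectors A"
  obtains u f where "u \<noteq> 0" "f \<noteq> 0" "outer u f \<in> A"
proof -
  define K where "K T = {z. T *v z = 0}" for T :: "complex^3^3"
  have K: "vec.subspace (K T)" for T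
    by (auto simp: K_def vec.subspace_def vec.add vec.scale)
  have "mat 1 \<in> A \<and> (mat 1 :: complex^3^3) \<noteq> 0"
    using A by (auto simp: matrix_algebra_def vec_eq_iff mat_def)
  \<comment> \<open>Kernels have dimension at most 3; the maximum principle applied next takes a
    strict bound.\<close>
  moreover have "\<forall>T. T \<in> A \<and> T \<noteq> 0 \<longrightarrow> vec.dim (K T) < 4"
    using dim_subset_UNIV_cart_gen[where 'n=3 and 'a=complex] by (simp add: less_Suc_eq_le numeral_eq_Suc)
  ultimately have "\<exists>T. (T \<in> A \<and> T \<noteq> 0) \<and> (\<forall>N. N \<in> A \<and> N \<noteq> 0 \<longrightarrow> vec.dim (K N) \<le> vec.dim (K T))"
    by (rule ex_has_greatest_nat[where P = "\<lambda>T. T \<in> A \<and> T \<noteq> 0" and f = "\<lambda>T. vec.dim (K T)"])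
  then obtain T where T: "T \<in> A" "T \<noteq> 0"
    and max: "\<And>N. N \<in> A \<Longrightarrow> N \<noteq> 0 \<Longrightarrow> vec.dim (K N) \<le> vec.dim (K T)"
    by auto
  have "\<exists>x. T *v x \<noteq> 0"
  proof (rule ccontr)
    assume "\<nexists>x. T *v x \<noteq> 0"
    then have "\<forall>x. T *v x = 0 *v x" by simp
    then show False using T(2) unfolding matrix_eq[symmetric] by (rule notE[rotated])
  qed
  then obtain x where x: "T *v x \<noteq> 0" ..
  define u where "u = T *v x"
  have "\<exists>c. T *v y = c *s u" for y
  proof (rule ccontr)
    assume y: "\<nexists>c. T *v y = c *s u"
    obtain S where S: "S \<in> A" "S *v u = y"
      using tr x unfolding transitive_on_vectors_def u_def by blast
    obtain w c where w: "w \<in> range ((*v) T)" "w \<noteq> 0" "(T ** S) *v w = c *s w"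
    proof (rule eigenvector_in_invariant_set[of "range ((*v) T)" "T ** S" u])
      fix w c assume "w \<in> range ((*v) T)"
      then obtain z where "w = T *v z" by auto
      then have "(T ** S) *v w - c *s w = T *v (S *v w - c *s z)"
        by (simp add: vec.diff vec.scale flip: matrix_vector_mul_assoc)
      then show "(T ** S) *v w - c *s w \<in> range ((*v) T)" by simp
    qed (use x u_def in auto)
    then obtain z where z: "w = T *v z" by auto
    define N where "N = T ** S ** T - mat c ** T"
    have Nv: "N *v v = (T ** S) *v (T *v v) - c *s (T *v v)" for v
      by (simp add: N_def mat_mult_mult_vec matrix_vector_mult_diff_rdistrib matrix_vector_mul_assoc)
    have "N *v x = T *v y - c *s u"
      using S(2) by (simp add: Nv flip: u_def matrix_vector_mul_assoc)
    then have "N \<noteq> 0" using y by fastforce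
    moreover have "N \<in> A"
      unfolding N_def using A T(1) S(1) by (intro matrix_algebra_shift) (auto simp: matrix_algebra_def)
    moreover have "K T \<subset> K N"
    proof
      show "K T \<subseteq> K N" by (auto simp: K_def Nv)
      \<comment> \<open>\<open>T\<close> sends \<open>z\<close> to the eigenvector \<open>w\<close>
        of \<open>T ** S\<close>, which is nonzero but killed by
        \<open>T ** S - mat c\<close>.\<close>
      have "z \<in> K N" "z \<notin> K T" using w z by (auto simp: K_def Nv)
      then show "K T \<noteq> K N" by blast
    qed
    then have "vec.dim (K T) < vec.dim (K N)"
      by (intro vec.dim_psubset) (simp add: vec.span_eq_iff[THEN iffD2, OF K])
    ultimately show False using max[of N] by simp
  qed
  then obtain c where c: "\<And>y. T *v y = c y *s u" by metis
  \<comment> \<open>Column j of \<open>T\<close> is \<open>T *v axis j 1\<close>, a multiple of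
    \<open>u\<close>; \<open>f\<close> collects the factors.\<close>
  define f where "f = (\<chi> j. c (axis j 1))"
  have "T = outer u f"
  proof -
    have "T$i$j = (T *v axis j 1)$i" for i j
      by (simp add: matrix_vector_mult_def axis_def if_distrib[of "(*) _"] cong: if_cong)
    then show ?thesis by (simp add: vec_eq_iff outer_def f_def c)
  qed
  moreover from this have "f \<noteq> 0" using T(2) by (auto simp: outer_def vec_eq_iff)
  moreover have "u \<noteq> 0" using x u_def by simp
  ultimately show thesis using that T(1) by blast
qed

text \<open>Multiplying \<open>outer u f\<close> on the left and right gives
  \<open>outer (S *v u) (f v* S')\<close>. The left factor is arbitrary by transitivity. So is the
  right one: a nonzero x annihilating every \<open>f v* S\<close> would make f vanish on every
  \<open>S *v x\<close>, that is, on all vectors. Rank-one matrices then sum to any matrix, column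
  by column.\<close>

theorem burnside_3:
  assumes A: "matrix_algebra A" and tr: "transitive_on_vectors A"
  shows "A = UNIV"
proof -
  obtain u f where uf: "u \<noteq> 0" "f \<noteq> 0" "outer u f \<in> A"
    using transitive_algebra_rank_one[OF A tr] .
  have mult: "X ** Y \<in> A" and add: "X + Y \<in> A" if "X \<in> A" "Y \<in> A" for X Y
    using A that by (auto simp: matrix_algebra_def)
  define W where "W = {f v* S | S. S \<in> A}"
  have "mat 0 ** mat 1 = (0 :: complex^3^3)"
    by (simp add: mat_def matrix_matrix_mult_def vec_eq_iff)
  then have "0 \<in> A" using A by (metis matrix_algebra_def)
  then have "vec.subspace W"
    unfolding vec.subspace_def W_def
  proof (intro conjI ballI allI)
    show "0 \<in> {f v* S |S. S \<in> A}"
      using \<open>0 \<in> A\<close> by (force simp: vector_matrix_mult_def vec_eq_iff)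
  next
    fix a b assume "a \<in> {f v* S |S. S \<in> A}" "b \<in> {f v* S |S. S \<in> A}"
    then obtain S S' where "a = f v* S" "b = f v* S'" "S \<in> A" "S' \<in> A" by auto
    then have "a + b = f v* (S + S')" "S + S' \<in> A"
      by (auto simp: add vector_matrix_mult_def vec_eq_iff sum.distrib algebra_simps)
    then show "a + b \<in> {f v* S |S. S \<in> A}" by auto
  next
    fix c a assume "a \<in> {f v* S |S. S \<in> A}"
    then obtain S where "a = f v* S" "S \<in> A" by auto
    then have "c *s a = f v* (mat c ** S)" "mat c ** S \<in> A"
      using A by (auto simp: vec_mult_mat_mult matrix_algebra_def)
    then show "c *s a \<in> {f v* S |S. S \<in> A}" by auto
  qed
  have W: "W = UNIV"
  proof (rule ccontr)
    assume "W \<noteq> UNIV"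
    then obtain x where x: "x \<noteq> 0" "\<And>w. w \<in> W \<Longrightarrow> (\<Sum>i\<in>UNIV. x$i * w$i) = 0"
      using proper_subspace_annihilator \<open>vec.subspace W\<close> by blast
    obtain i where i: "f$i \<noteq> 0" using uf(2) by (auto simp: vec_eq_iff)
    obtain S where S: "S \<in> A" "S *v x = axis i 1"
      using tr x(1) unfolding transitive_on_vectors_def by blast
    have "(\<Sum>i\<in>UNIV. x$i * (f v* S)$i) = (\<Sum>j\<in>UNIV. f$j * (S *v x)$j)"
      by (simp add: vector_matrix_mult_def matrix_vector_mult_def sum_3 algebra_simps)
    also have "\<dots> = f$i"
      unfolding S by (simp add: axis_def if_distrib[of "(*) _"] cong: if_cong)
    finally show False using x(2)[of "f v* S"] S(1) i by (auto simp: W_def)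
  qed
  have outer: "outer y g \<in> A" for y g
  proof -
    obtain S where S: "S \<in> A" "S *v u = y"
      using tr uf(1) unfolding transitive_on_vectors_def by blast
    obtain S' where S': "S' \<in> A" "f v* S' = g"
      using UNIV_I[of g] unfolding W[symmetric] W_def by blast
    have "S ** outer u f ** S' = outer y g"
      by (simp add: outer_mult_left outer_mult_right S S')
    then show ?thesis using mult S(1) S'(1) uf(3) by metis
  qed
  have "M \<in> A" for M
  proof -
    have "M = outer (column 1 M) (axis 1 1) + outer (column 2 M) (axis 2 1)
        + outer (column 3 M) (axis 3 1)"
      by (simp add: vec_eq_iff forall_3 outer_def column_def axis_def)
    then show ?thesis using outer add by metis
  qed
  then show ?thesis by blast
qed

section \<open>Hermitian form and Schur's lemma\<close>

lemma herm_add_left: "herm (x + y) z = herm x z + herm y z"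
  and herm_add_right: "herm z (x + y) = herm z x + herm z y"
  and herm_scale_left: "herm (c *s x) z = c * herm x z"
  and herm_scale_right: "herm z (c *s x) = cnj c * herm z x"
  and herm_diff_left: "herm (x - y) z = herm x z - herm y z"
  and herm_diff_right: "herm z (x - y) = herm z x - herm z y"
  and herm_zero [simp]: "herm 0 z = 0" "herm z 0 = 0"
  by (simp_all add: herm_def algebra_simps)

lemmas herm_simps = herm_add_left herm_add_right herm_diff_left herm_diff_right
  herm_scale_left herm_scale_right

lemma herm_commute: "herm w z = cnj (herm z w)"
  by (simp add: herm_def algebra_simps)

lemma herm_nondegenerate_left:
  assumes "\<And>w. herm x w = herm y w"
  shows "x = y"
  using assms[of "axis 1 1"] assms[of "axis 2 1"] assms[of "axis 3 1"]
  by (simp add: herm_def vec_eq_iff forall_3 axis_def)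

lemma proper_subspace_herm_perp:
  assumes "vec.subspace W" "W \<noteq> UNIV"
  obtains u where "u \<noteq> 0" "\<And>w. w \<in> W \<Longrightarrow> herm w u = 0"
proof -
  obtain u where u: "u \<noteq> 0" "\<And>w. w \<in> W \<Longrightarrow> (\<Sum>i\<in>UNIV. u$i * w$i) = 0"
    using proper_subspace_annihilator[OF assms] by blast
  show thesis
  proof
    \<comment> \<open>Conjugating and reversing the coordinates turns the bilinear pairing with
      \<open>u\<close> into \<open>herm\<close>, which pairs first with third coordinates.\<close>
    let ?u = "vector [cnj (u$3), cnj (u$2), cnj (u$1)] :: complex^3"
    show "?u \<noteq> 0" using u(1) by (auto simp: vec_eq_iff forall_3)
    show "herm w ?u = 0" if "w \<in> W" for w
      using u(2)[OF that] by (simp add: herm_def sum_3 algebra_simps)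
  qed
qed

text \<open>The three differences are, up to sign, the coordinates of the cross product; if all
  vanish, the ratio at a nonzero coordinate of \<open>a\<close> makes \<open>b\<close> a multiple of
  \<open>a\<close>.\<close>

lemma independent_cross_nonzero:
  fixes a b :: "'a::field^3"
  assumes "a \<noteq> 0" and ind: "\<And>c. b \<noteq> c *s a"
  shows "a$1 * b$2 \<noteq> a$2 * b$1 \<or> a$1 * b$3 \<noteq> a$3 * b$1 \<or> a$2 * b$3 \<noteq> a$3 * b$2"
proof (rule ccontr)
  assume *: "\<not> ?thesis"
  obtain i where i: "a$i \<noteq> 0" using assms(1) by (auto simp: vec_eq_iff)
  have "a$i * b$j = a$j * b$i" for j
    using * exhaust_3[of i] exhaust_3[of j] by (auto simp: mult.commute)
  then have "b = (b$i / a$i) *s a"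
    using i by (simp add: vec_eq_iff field_simps)
  with ind show False by blast
qed

text \<open>\<open>p\<close> is the cross product of the coefficient rows of the two equations.
  Every solution has zero cross product with \<open>p\<close>, hence is a multiple of it.\<close>

lemma two_equations_solution_line:
  assumes "u \<noteq> 0" and ind: "\<And>c. v \<noteq> c *s u"
    and x: "x \<noteq> 0" "herm x u = 0" "herm x v = 0"
    and y: "herm y u = 0" "herm y v = 0"
  obtains c where "y = c *s x"
proof -
  define a b where "a = cnj (u$3)" and "b = cnj (u$2)"
  define c where "c = cnj (u$1)"
  define a' b' c' where "a' = cnj (v$3)" and "b' = cnj (v$2)" and "c' = cnj (v$1)"
  define p where "p = (vector [b * c' - c * b', c * a' - a * c', a * b' - b * a'] :: complex^3)"
  have p: "p \<noteq> 0"
    using independent_cross_nonzero[OF assms(1,2)]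
    unfolding p_def a_def b_def c_def a'_def b'_def c'_def
    by (auto simp: vec_eq_iff forall_3 mult.commute simp flip: complex_cnj_mult)
  have "\<exists>k. z = k *s p" if "herm z u = 0" "herm z v = 0" for z
  proof -
    have eq: "z$1 * a + z$2 * b + z$3 * c = 0" "z$1 * a' + z$2 * b' + z$3 * c' = 0"
      using that by (simp_all add: herm_def a_def b_def c_def a'_def b'_def c'_def)
    have "z$1 * p$2 = z$2 * p$1" "z$1 * p$3 = z$3 * p$1" "z$2 * p$3 = z$3 * p$2"
      unfolding p_def using eq by (simp_all, algebra+)
    then show ?thesis
      using independent_cross_nonzero[OF p, of z] by (auto simp: mult.commute)
  qed
  then obtain k l where kl: "x = k *s p" "y = l *s p" using x y by metis
  then have "k \<noteq> 0" using x(1) by auto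
  then have "y = (l / k) *s x" using kl by simp
  then show thesis using that by blast
qed

section \<open>Matrix ring identities, real and complex spans, and Schur's lemma\<close>

lemma matrix_mult_mat_left: "(X :: complex^3^3) ** (mat c ** (Y :: complex^3^3)) = mat c ** (X ** Y)"
  unfolding matrix_mul_assoc mat_mult_right[of X c] ..

lemma mat_ii_twice: "mat \<i> ** (mat \<i> ** (X :: complex^3^3)) = - X"
  by (simp add: matrix_matrix_mult_def mat_def vec_eq_iff forall_3 sum_3 flip: mult.assoc)

lemma mat_complex_decomp:
  "mat c ** (X :: complex^3^3) = Re c *\<^sub>R X + mat \<i> ** (Im c *\<^sub>R X)"
proof -
  have "c * z = Re c *\<^sub>R z + \<i> * (Im c *\<^sub>R z)" for z
    by (simp add: complex_eq_iff)
  then show ?thesis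
    by (simp add: matrix_matrix_mult_def mat_def vec_eq_iff forall_3 sum_3)
qed

lemma matrix_scaleR_left: "(k *\<^sub>R X) ** (Y :: complex^3^3) = k *\<^sub>R (X ** Y)"
  and matrix_scaleR_right: "X ** (k *\<^sub>R (Y :: complex^3^3)) = k *\<^sub>R (X ** Y)"
  by (simp_all add: matrix_matrix_mult_def vec_eq_iff sum_3 scaleR_add_right)

lemma matrix_minus_left: "(- X) ** Y = - (X ** (Y :: complex^3^3))"
  and matrix_minus_right: "X ** (- Y) = - (X ** (Y :: complex^3^3))"
  by (simp_all add: matrix_matrix_mult_def vec_eq_iff sum_negf)

lemma matrix_zero_mult: "0 ** (Y :: complex^3^3) = 0" "X ** (0 :: complex^3^3) = 0"
  by (simp_all add: matrix_matrix_mult_def vec_eq_iff)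

lemma matrix_add_left: "(X + Y) ** Z = X ** Z + Y ** (Z :: complex^3^3)"
  by (simp add: matrix_matrix_mult_def vec_eq_iff sum.distrib algebra_simps)

lemma matrix_diff_left: "(X - Y) ** Z = X ** Z - Y ** (Z :: complex^3^3)"
  and matrix_diff_right: "Z ** (X - Y) = Z ** X - Z ** (Y :: complex^3^3)"
  by (simp_all add: matrix_matrix_mult_def vec_eq_iff sum_subtractf algebra_simps)

lemmas matrix_ring_simps = matrix_diff_left matrix_diff_right matrix_add_ldistrib matrix_add_left matrix_minus_left
  matrix_minus_right matrix_scaleR_left matrix_scaleR_right matrix_zero_mult

lemma span_mult_closed:
  fixes G :: "(complex^3^3) set"
  assumes mult: "\<And>X Y. X \<in> G \<Longrightarrow> Y \<in> G \<Longrightarrow> X ** Y \<in> G"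
    and X: "X \<in> span G" and Y: "Y \<in> span G"
  shows "X ** Y \<in> span G"
proof -
  have 1: "X ** Z \<in> span G" if Z: "Z \<in> G" for Z
    using X
  proof (induction rule: span_induct)
    case base
    show ?case unfolding subspace_def by (auto simp: matrix_ring_simps span_zero span_add span_scale)
  qed (use mult Z span_base in blast)
  show ?thesis
    using Y
  proof (induction rule: span_induct)
    case base
    show ?case unfolding subspace_def by (auto simp: matrix_ring_simps span_zero span_add span_scale)
  qed (use 1 in blast)
qed

text \<open>The complex span is written through the real one because the conjugation is defined by
  changing the sign of the second summand.\<close>

definition cspan :: "(complex^3^3) set \<Rightarrow> (complex^3^3) set" where
  "cspan G = {X + mat \<i> ** Y | X Y. X \<in> span G \<and> Y \<in> span G}"

lemma cspanI: "X \<in> span G \<Longrightarrow> Y \<in> span G \<Longrightarrow> X + mat \<i> ** Y \<in> cspan G"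
  unfolding cspan_def by blast

lemma subset_cspan: "span G \<subseteq> cspan G"
proof
  fix X assume "X \<in> span G"
  moreover have "X = X + mat \<i> ** 0" by (simp add: matrix_zero_mult)
  ultimately show "X \<in> cspan G" using cspanI span_zero by metis
qed

lemma matrix_algebra_cspan:
  assumes one: "mat 1 \<in> G" and mult: "\<And>X Y. X \<in> G \<Longrightarrow> Y \<in> G \<Longrightarrow> X ** Y \<in> G"
  shows "matrix_algebra (cspan G)"
  unfolding matrix_algebra_def
proof (intro conjI ballI allI)
  show "mat 1 \<in> cspan G" using subset_cspan one span_base by blast
next
  fix Z Z' assume "Z \<in> cspan G" "Z' \<in> cspan G"
  then obtain X Y X' Y' where Z: "Z = X + mat \<i> ** Y" "Z' = X' + mat \<i> ** Y'"
    and mem: "X \<in> span G" "Y \<in> span G" "X' \<in> span G" "Y' \<in> span G"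
    unfolding cspan_def by blast
  have "Z + Z' = (X + X') + mat \<i> ** (Y + Y')"
    by (simp add: Z matrix_ring_simps)
  moreover have "\<dots> \<in> cspan G" by (intro cspanI span_add mem)
  ultimately show "Z + Z' \<in> cspan G" by (rule ssubst)
  have "Z ** Z' = (X ** X' - Y ** Y') + mat \<i> ** (X ** Y' + Y ** X')"
    by (simp add: Z matrix_ring_simps mat_ii_twice matrix_mult_mat_left[of X] matrix_mult_mat_left[of Y]
        flip: matrix_mul_assoc)
  moreover have "\<dots> \<in> cspan G"
    by (intro cspanI span_add span_diff span_mult_closed[OF mult] mem)
  ultimately show "Z ** Z' \<in> cspan G" by (rule ssubst)
next
  fix c Z assume "Z \<in> cspan G"
  then obtain X Y where Z: "Z = X + mat \<i> ** Y"
    and mem: "X \<in> span G" "Y \<in> span G"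
    unfolding cspan_def by blast
  have "mat c ** Z = (Re c *\<^sub>R X - Im c *\<^sub>R Y) + mat \<i> ** (Re c *\<^sub>R Y + Im c *\<^sub>R X)"
    by (simp add: Z mat_complex_decomp[of c] matrix_ring_simps mat_ii_twice)
  moreover have "\<dots> \<in> cspan G"
    by (intro cspanI span_add span_diff span_scale mem)
  ultimately show "mat c ** Z \<in> cspan G" by (rule ssubst)
qed

lemma cspan_commute:
  assumes "\<And>g. g \<in> G \<Longrightarrow> g ** N = N ** g" and "S \<in> cspan G"
  shows "S ** N = N ** S"
proof -
  have *: "X ** N = N ** X" if "X \<in> span G" for X
    using that
  proof (induction rule: span_induct)
    case base
    show ?case unfolding subspace_def by (auto simp: matrix_ring_simps)
  qed (use assms(1) in blast)
  obtain X Y where "S = X + mat \<i> ** Y" "X \<in> span G" "Y \<in> span G"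
    using assms(2) unfolding cspan_def by blast
  then show ?thesis
    using *[of X] *[of Y] by (simp add: matrix_ring_simps matrix_mult_mat_left[of N] flip: matrix_mul_assoc)
qed

text \<open>An eigenvector \<open>w\<close> of F is carried to any x by some S in the complex span,
  and S commutes with F, so x has the same eigenvalue.\<close>

lemma schur:
  assumes tr: "transitive_on_vectors (cspan G)"
    and add: "\<And>x y. F (x + y) = F x + F y" and scale: "\<And>c x. F (c *s x) = c *s F x"
    and comm: "\<And>g x. g \<in> G \<Longrightarrow> F (g *v x) = g *v F x"
  obtains c where "\<And>x. F x = c *s (x :: complex^3)"
proof -
  define N where "N = matrix F"
  have "Vector_Spaces.linear (*s) (*s) F"
    by (simp add: Vector_Spaces.linear_iff vec.vector_space_axioms add scale)
  then have N: "N *v x = F x" for x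
    unfolding N_def by (rule matrix_works)
  have comm': "S ** N = N ** S" if "S \<in> cspan G" for S
    by (rule cspan_commute[OF _ that]) (simp add: matrix_eq N comm flip: matrix_vector_mul_assoc)
  obtain w c where w: "w \<noteq> 0" "N *v w = c *s w"
    using eigenvector_in_invariant_set[of UNIV N "axis 1 1"] by (auto simp: axis_eq_0_iff)
  show thesis
  proof
    fix x
    obtain S where S: "S \<in> cspan G" "S *v w = x"
      using tr w(1) unfolding transitive_on_vectors_def by blast
    have "N *v x = (N ** S) *v w" by (simp add: S(2) flip: matrix_vector_mul_assoc)
    also have "\<dots> = S *v (N *v w)" by (simp add: matrix_vector_mul_assoc comm'[OF S(1)])
    also have "\<dots> = c *s x" by (simp add: w(2) vec.scale S(2))
    finally show "F x = c *s x" by (simp add: N)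
  qed
qed

section \<open>Antilinear intertwiners\<close>

lemma SU21_herm: "g \<in> carrier SU21 \<Longrightarrow> herm (g *v z) (g *v w) = herm z w"
  by (simp add: SU21_def)

lemma subgroup_SU21_mult: "subgroup G SU21 \<Longrightarrow> g \<in> G \<Longrightarrow> h \<in> G \<Longrightarrow> g ** h \<in> G"
  using subgroup.m_closed[of G SU21 g h] by (simp add: SU21_def)

lemma subgroup_SU21_one: "subgroup G SU21 \<Longrightarrow> mat 1 \<in> G"
  using subgroup.one_closed[of G SU21] by (simp add: SU21_def)

text \<open>For an isometry the inverse is the \<open>herm\<close>-adjoint, so moving a group
  element across the form stays inside G.\<close>

lemma subgroup_SU21_inverse:
  assumes G: "subgroup G SU21" and g: "g \<in> G"
  obtains h where "h \<in> G" "\<And>x. h *v (g *v x) = x" "\<And>x. g *v (h *v x) = x"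
    "\<And>x y. herm (g *v x) y = herm x (h *v y)" "\<And>x y. herm x (g *v y) = herm (h *v x) y"
proof -
  interpret group SU21 by (rule group_SU21)
  have gc: "g \<in> carrier SU21" using G g by (rule subgroup.mem_carrier)
  define h where "h = inv\<^bsub>SU21\<^esub> g"
  have h: "h \<in> G" unfolding h_def using G g by (rule subgroup.m_inv_closed)
  have "h ** g = mat 1" "g ** h = mat 1"
    using l_inv[OF gc] r_inv[OF gc] by (simp_all add: h_def SU21_def)
  then have inv: "h *v (g *v x) = x" "g *v (h *v x) = x" for x
    by (simp_all add: matrix_vector_mul_assoc)
  have "herm (g *v x) y = herm x (h *v y)" "herm x (g *v y) = herm (h *v x) y" for x y
    using SU21_herm[OF gc, of x "h *v y"] SU21_herm[OF gc, of "h *v x" y] by (simp_all add: inv)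
  then show thesis using that h inv by blast
qed

text \<open>If the orbit space \<open>W\<close> of x were proper, some \<open>u\<close> would be
  orthogonal to it. Invariance of \<open>W\<close> makes a translate \<open>g *v u\<close>,
  independent of \<open>u\<close>, orthogonal too, so \<open>W\<close> would lie in the line of x,
  which G does not preserve.\<close>

lemma irreducible_transitive:
  assumes G: "subgroup G SU21"
    and no_line: "\<And>v. v \<noteq> 0 \<Longrightarrow> \<exists>g\<in>G. \<forall>c. g *v v \<noteq> c *s v"
  shows "transitive_on_vectors (cspan G)"
  unfolding transitive_on_vectors_def
proof (intro allI impI)
  fix x y :: "complex^3" assume x: "x \<noteq> 0"
  note mult = subgroup_SU21_mult[OF G]
  have A: "matrix_algebra (cspan G)"
    by (rule matrix_algebra_cspan[OF subgroup_SU21_one[OF G] mult])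
  have GA: "G \<subseteq> cspan G" using subset_cspan span_superset by blast
  have mat0: "mat 0 ** (mat 1 :: complex^3^3) = 0"
    by (simp add: mat_def matrix_matrix_mult_def vec_eq_iff)
  define W where "W = (\<lambda>S. S *v x) ` cspan G"
  have W: "vec.subspace W"
    unfolding vec.subspace_def
  proof (intro conjI ballI allI)
    show "0 \<in> W"
      unfolding W_def using A mat0 unfolding matrix_algebra_def by (metis imageI matrix_vector_mult_0)
    fix a b c assume "a \<in> W" "b \<in> W"
    then obtain S S' where S: "S \<in> cspan G" "S' \<in> cspan G" "a = S *v x" "b = S' *v x"
      unfolding W_def by blast
    then have "S + S' \<in> cspan G" "mat c ** S \<in> cspan G"
      using A by (simp_all add: matrix_algebra_def)
    moreover have "a + b = (S + S') *v x" "c *s a = (mat c ** S) *v x"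
      by (simp_all add: S matrix_vector_mult_add_rdistrib mat_mult_mult_vec)
    ultimately show "a + b \<in> W" "c *s a \<in> W" by (simp_all add: W_def)
  qed
  have gW: "g *v w \<in> W" if "g \<in> G" "w \<in> W" for g w
  proof -
    obtain S where S: "S \<in> cspan G" "w = S *v x" using \<open>w \<in> W\<close> unfolding W_def by blast
    then have "g ** S \<in> cspan G" using A GA \<open>g \<in> G\<close> by (auto simp: matrix_algebra_def)
    then show ?thesis by (auto simp: W_def S matrix_vector_mul_assoc)
  qed
  have xW: "x \<in> W"
    unfolding W_def using A by (force simp: matrix_algebra_def image_iff intro: bexI[of _ "mat 1"])
  have "W = UNIV"
  proof (rule ccontr)
    assume "W \<noteq> UNIV"
    then obtain u where u: "u \<noteq> 0" "\<And>w. w \<in> W \<Longrightarrow> herm w u = 0"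
      using proper_subspace_herm_perp[OF W] by blast
    obtain g where g: "g \<in> G" "\<And>c. g *v u \<noteq> c *s u" using no_line[OF u(1)] by blast
    obtain h where h: "h \<in> G" "\<And>c. h *v x \<noteq> c *s x" using no_line[OF x] by blast
    obtain g' where g': "g' \<in> G" "\<And>z w. herm z (g *v w) = herm (g' *v z) w"
      using subgroup_SU21_inverse[OF G g(1)] by metis
    have "herm w (g *v u) = 0" if "w \<in> W" for w
      using u(2)[OF gW[OF g'(1) that]] by (simp add: g'(2))
    then obtain c where "h *v x = c *s x"
      using two_equations_solution_line[OF u(1) g(2) x u(2) _ u(2)] xW gW[OF h(1) xW] by metis
    then show False using h(2) by blast
  qed
  then show "\<exists>S\<in>cspan G. S *v x = y" unfolding W_def by (metis UNIV_I imageE)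
qed

lemma span_real_trace:
  assumes "\<And>g. g \<in> G \<Longrightarrow> trace g \<in> \<real>" and "X \<in> span (G :: (complex^3^3) set)"
  shows "trace X \<in> \<real>"
  using assms(2)
proof (induction rule: span_induct)
  case base
  have "trace (c *\<^sub>R X) = c *\<^sub>R trace X" for c and X :: "complex^3^3"
    by (simp add: trace_def scaleR_sum_right)
  then show ?case
    unfolding subspace_def by (auto simp: trace_add scaleR_conv_of_real) (simp add: trace_def)
qed (use assms(1) in blast)

lemma trace_mult_outer: "trace (X ** outer u f) = (\<Sum>j\<in>UNIV. f$j * (X *v u)$j)"
  unfolding outer_mult_left by (simp add: trace_def outer_def mult.commute)

text \<open>By nondegeneracy of the trace form, the real span of a matrix group with real traces is
  a real form of its complex span.\<close>

lemma real_traces_real_form: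
  assumes full: "cspan G = UNIV" and mult: "\<And>X Y. X \<in> G \<Longrightarrow> Y \<in> G \<Longrightarrow> X ** Y \<in> G"
    and real: "\<And>g. g \<in> G \<Longrightarrow> trace g \<in> \<real>"
    and X: "X \<in> span G" and Y: "Y \<in> span G" and eq: "X + mat \<i> ** Y = 0"
  shows "X = 0 \<and> Y = 0"
proof -
  have tr_i: "trace (mat \<i> ** Z) = \<i> * trace Z" for Z :: "complex^3^3"
    by (simp add: trace_def matrix_matrix_mult_def mat_def sum_3 algebra_simps)
  have span0: "trace (X ** Z) = 0 \<and> trace (Y ** Z) = 0" if Z: "Z \<in> span G" for Z
  proof -
    have "trace (X ** Z) + \<i> * trace (Y ** Z) = trace ((X + mat \<i> ** Y) ** Z)"
      by (simp add: matrix_ring_simps trace_add tr_i flip: matrix_mul_assoc)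
    also have "\<dots> = 0" by (simp add: eq matrix_ring_simps) (simp add: trace_def)
    finally have "trace (X ** Z) + \<i> * trace (Y ** Z) = 0" .
    moreover have "trace (X ** Z) \<in> \<real>" "trace (Y ** Z) \<in> \<real>"
      using span_real_trace[OF real] span_mult_closed[OF mult] X Y Z by blast+
    ultimately show ?thesis by (auto simp: complex_eq_iff complex_is_Real_iff)
  qed
  have all0: "trace (N ** Z) = 0" if N: "\<And>Z. Z \<in> span G \<Longrightarrow> trace (N ** Z) = 0" for N Z
  proof -
    obtain P Q where "Z = P + mat \<i> ** Q" "P \<in> span G" "Q \<in> span G"
      using UNIV_I[of Z] unfolding full[symmetric] cspan_def by blast
    then show ?thesis
      using N by (simp add: matrix_ring_simps matrix_mult_mat_left[of N] trace_add tr_i)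
  qed
  have "N = 0" if N: "\<And>Z. trace (N ** Z) = 0" for N :: "complex^3^3"
  proof -
    \<comment> \<open>The trace against an elementary matrix reads off one entry of
      \<open>N\<close>.\<close>
    have "(N *v axis j 1)$i = 0" for i j
      using N[of "outer (axis j 1) (axis i 1)"] unfolding trace_mult_outer
      by (simp add: axis_def if_distrib[of "\<lambda>x. x * _"] cong: if_cong)
    moreover have "(N *v axis j 1)$i = N$i$j" for i j
      by (simp add: matrix_vector_mult_def axis_def if_distrib[of "(*) _"] cong: if_cong)
    ultimately show ?thesis by (simp add: vec_eq_iff)
  qed
  then show ?thesis using all0 span0 by blast
qed

text \<open>\<open>\<phi>\<close> is antilinear, injective and commutes with left multiplication by
  G, so \<open>outer v e\<close> may stand for v. Its image is a matrix; applying that to a fixed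
  \<open>w\<close> gives a vector, with \<open>w\<close> chosen so that \<open>J e\<close> is
  nonzero.\<close>

lemma antilinear_intertwiner:
  assumes full: "cspan G = UNIV" and mult: "\<And>X Y. X \<in> G \<Longrightarrow> Y \<in> G \<Longrightarrow> X ** Y \<in> G"
    and one: "mat 1 \<in> G" and real: "\<And>g. g \<in> G \<Longrightarrow> trace g \<in> \<real>"
  obtains J x0 where "\<And>x y. J (x + y) = J x + J y" "\<And>c x. J (c *s x) = cnj c *s J x"
    "\<And>g x. g \<in> G \<Longrightarrow> J (g *v x) = g *v J x" "J x0 \<noteq> (0 :: complex^3)"
proof -
  have "\<exists>X Y. X \<in> span G \<and> Y \<in> span G \<and> Z = X + mat \<i> ** Y" for Z
    using UNIV_I[of Z] unfolding full[symmetric] cspan_def by blast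
  then obtain P Q where PQ: "\<And>Z. P Z \<in> span G" "\<And>Z. Q Z \<in> span G" "\<And>Z. Z = P Z + mat \<i> ** Q Z"
    by metis
  define \<phi> where "\<phi> Z = P Z - mat \<i> ** Q Z" for Z
  \<comment> \<open>Real traces enter here: the difference of two decompositions is a relation in
    the real span, which must be trivial.\<close>
  have uniq: "P (X + mat \<i> ** Y) = X \<and> Q (X + mat \<i> ** Y) = Y"
    if "X \<in> span G" "Y \<in> span G" for X Y
  proof -
    let ?Z = "X + mat \<i> ** Y"
    have "(P ?Z - X) + mat \<i> ** (Q ?Z - Y) = (P ?Z + mat \<i> ** Q ?Z) - ?Z"
      by (simp only: matrix_diff_right) (simp add: algebra_simps)
    also have "\<dots> = 0" unfolding PQ(3)[of ?Z, symmetric] by (rule diff_self)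
    finally show ?thesis
      using real_traces_real_form[OF full mult real, of "P ?Z - X" "Q ?Z - Y"]
      by (simp add: that PQ span_diff)
  qed
  have \<phi>: "\<phi> (X + mat \<i> ** Y) = X - mat \<i> ** Y" if "X \<in> span G" "Y \<in> span G" for X Y
    unfolding \<phi>_def by (simp add: uniq[OF that])
  have add: "\<phi> (Z + Z') = \<phi> Z + \<phi> Z'" for Z Z'
  proof -
    have "Z + Z' = (P Z + P Z') + mat \<i> ** (Q Z + Q Z')"
      by (subst PQ(3)[of Z], subst PQ(3)[of Z']) (simp add: matrix_ring_simps)
    also have "\<phi> \<dots> = (P Z + P Z') - mat \<i> ** (Q Z + Q Z')"
      by (intro \<phi> span_add PQ)
    also have "\<dots> = \<phi> Z + \<phi> Z'" by (simp add: \<phi>_def matrix_ring_simps)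
    finally show ?thesis .
  qed
  have scale: "\<phi> (mat c ** Z) = mat (cnj c) ** \<phi> Z" for c Z
  proof -
    have "mat c ** Z = (Re c *\<^sub>R P Z - Im c *\<^sub>R Q Z) + mat \<i> ** (Re c *\<^sub>R Q Z + Im c *\<^sub>R P Z)"
      by (subst PQ(3)[of Z]) (simp add: mat_complex_decomp[of c] matrix_ring_simps mat_ii_twice)
    also have "\<phi> \<dots> = (Re c *\<^sub>R P Z - Im c *\<^sub>R Q Z) - mat \<i> ** (Re c *\<^sub>R Q Z + Im c *\<^sub>R P Z)"
      by (intro \<phi> span_add span_diff span_scale PQ)
    also have "\<dots> = mat (cnj c) ** \<phi> Z"
      unfolding \<phi>_def mat_complex_decomp[of "cnj c"]
      by (simp add: matrix_ring_simps mat_ii_twice scaleR_add_right scaleR_diff_right)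
    finally show ?thesis .
  qed
  have left: "\<phi> (g ** Z) = g ** \<phi> Z" if g: "g \<in> G" for g Z
  proof -
    have "g ** Z = g ** P Z + mat \<i> ** (g ** Q Z)"
      by (subst PQ(3)[of Z]) (simp add: matrix_ring_simps matrix_mult_mat_left[of g])
    also have "\<phi> \<dots> = g ** P Z - mat \<i> ** (g ** Q Z)"
      by (intro \<phi> span_mult_closed[OF mult] span_base[OF g] PQ)
    also have "\<dots> = g ** \<phi> Z"
      by (simp add: \<phi>_def matrix_ring_simps matrix_mult_mat_left[of g])
    finally show ?thesis .
  qed
  have inj: "Z = 0" if "\<phi> Z = 0" for Z
  proof -
    have "P Z + mat \<i> ** (- Q Z) = 0" using that by (simp add: \<phi>_def matrix_ring_simps)
    then have "P Z = 0 \<and> - Q Z = 0"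
      using real_traces_real_form[OF full mult real, of "P Z" "- Q Z"] PQ span_neg by blast
    then show ?thesis using PQ(3)[of Z] by (simp add: matrix_ring_simps)
  qed
  define e where "e = (axis 1 1 :: complex^3)"
  have "outer e e \<noteq> 0" by (simp add: e_def outer_def vec_eq_iff axis_def)
  then have "\<phi> (outer e e) \<noteq> 0" using inj by blast
  then have "\<not> (\<forall>w. \<phi> (outer e e) *v w = 0 *v w)" unfolding matrix_eq[symmetric] .
  then obtain w where w: "\<phi> (outer e e) *v w \<noteq> 0" by auto
  define J where "J v = \<phi> (outer v e) *v w" for v
  show thesis
  proof
    fix x y
    have "outer (x + y) e = outer x e + outer y e"
      by (simp add: outer_def vec_eq_iff algebra_simps)
    then show "J (x + y) = J x + J y" 
      by (simp add: J_def add matrix_vector_mult_add_rdistrib)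
  next
    fix c x
    have "outer (c *s x) e = mat c ** outer x e" by (simp add: outer_mult_left)
    then show "J (c *s x) = cnj c *s J x" by (simp add: J_def scale mat_mult_mult_vec)
  next
    fix g x assume "g \<in> G"
    then show "J (g *v x) = g *v J x"
      by (simp add: J_def left matrix_vector_mul_assoc flip: outer_mult_left)
  next
    show "J e \<noteq> 0" using w by (simp add: J_def)
  qed
qed

section \<open>Real structures\<close>

lemma Re_herm_scale: "Re (herm (c *s x) (c *s x)) = (cmod c)\<^sup>2 * Re (herm x x)"
proof -
  have "herm (c *s x) (c *s x) = (c * cnj c) * herm x x" by (simp add: herm_simps)
  then show ?thesis by (simp flip: complex_norm_square)
qed

lemma herm_self: "herm x x = complex_of_real (Re (herm x x))"
  by (simp add: complex_eq_iff herm_self_real)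

lemma herm_self_nonneg_on_positive_plane:
  assumes "x$1 = x$3"
  shows "Re (herm x x) = 2 * (cmod (x$1))\<^sup>2 + (cmod (x$2))\<^sup>2"
  using assms by (simp add: herm_def cmod_power2) (simp add: power2_eq_square)

text \<open>The combination of \<open>a\<close> and \<open>b\<close> that lies in the positive definite plane
  \<open>x\<^sub>1 = x\<^sub>3\<close> would otherwise have negative norm.\<close>

lemma perp_of_negative_is_positive:
  assumes a: "Re (herm a a) < 0" and ab: "herm a b = 0" and b: "b \<noteq> 0"
  shows "Re (herm b b) > 0"
proof (rule ccontr)
  assume neg: "\<not> Re (herm b b) > 0"
  define p q where "p = b$1 - b$3" and "q = a$1 - a$3"
  \<comment> \<open>The functional z\<mapsto>z_1 - z_3 takes the value \<open>q\<close> at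
    \<open>a\<close> and \<open>p\<close> at \<open>b\<close>, so it cancels on this
    combination.\<close>
  define x where "x = p *s a - q *s b"
  have "x$1 = x$3" by (simp add: x_def p_def q_def algebra_simps)
  then have "Re (herm x x) \<ge> 0" using herm_self_nonneg_on_positive_plane[of x] by simp
  moreover have "herm b a = 0" using ab herm_commute[of b a] by simp
  then have "herm x x = herm (p *s a) (p *s a) + herm (q *s b) (q *s b)"
    using ab by (simp add: x_def herm_simps)
  then have "Re (herm x x) = (cmod p)\<^sup>2 * Re (herm a a) + (cmod q)\<^sup>2 * Re (herm b b)"
    by (simp add: Re_herm_scale)
  moreover have "(cmod q)\<^sup>2 * Re (herm b b) \<le> 0"
    using neg by (simp add: mult_nonneg_nonpos)
  ultimately have "(cmod p)\<^sup>2 * Re (herm a a) \<ge> 0" by linarith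
  \<comment> \<open>\<open>a\<close> is negative, so its coefficient must vanish; then
    \<open>b\<close> itself lies in the positive definite plane.\<close>
  then have "p = 0" using a by (simp add: zero_le_mult_iff not_le)
  then have "b$1 = b$3" by (simp add: p_def)
  moreover from herm_self_nonneg_on_positive_plane[OF this]
  have "2 * (cmod (b$1))\<^sup>2 + (cmod (b$2))\<^sup>2 \<le> 0" using neg by simp
  then have "b$1 = 0" "b$2 = 0"
    using zero_le_power2[of "cmod (b$1)"] zero_le_power2[of "cmod (b$2)"]
    by (smt (verit) norm_eq_zero power_eq_0_iff zero_le_power2)+
  ultimately show False using b by (simp add: vec_eq_iff forall_3)
qed

text \<open>An antiunitary involution, that is, a complex conjugation compatible with
  \<open>herm\<close>; the form is real on its fixed vectors.\<close>

definition real_structure :: "(complex^3 \<Rightarrow> complex^3) \<Rightarrow> bool" where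
  "real_structure J \<longleftrightarrow> (\<forall>x y. J (x + y) = J x + J y) \<and> (\<forall>c x. J (c *s x) = cnj c *s J x) \<and>
     (\<forall>x. J (J x) = x) \<and> (\<forall>x y. herm (J x) (J y) = cnj (herm x y))"

text \<open>Nondegeneracy represents h z w as \<open>herm (F z) w\<close> with F linear; invariance
  of both forms makes F commute with G, so Schur's lemma applies.\<close>

lemma invariant_sesquilinear_form_scalar:
  assumes G: "subgroup G SU21" and tr: "transitive_on_vectors (cspan G)"
    and h: "\<And>x y z. h (x + y) z = h x z + h y z" "\<And>c x z. h (c *s x) z = c * h x z"
      "\<And>x y z. h z (x + y) = h z x + h z y" "\<And>c x z. h z (c *s x) = cnj c * h z x"
    and inv: "\<And>g x y. g \<in> G \<Longrightarrow> h (g *v x) (g *v y) = h x y"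
  obtains c where "\<And>x y. h x y = c * herm x y"
proof -
  define F where "F z = (vector [h z (axis 3 1), h z (axis 2 1), h z (axis 1 1)] :: complex^3)" for z
  have F: "herm (F z) w = h z w" for z w
  proof -
    have "w = w$1 *s axis 1 1 + w$2 *s axis 2 1 + w$3 *s axis 3 1"
      by (simp add: vec_eq_iff forall_3 axis_def)
    then have "h z w = h z (w$1 *s axis 1 1 + w$2 *s axis 2 1 + w$3 *s axis 3 1)" by metis
    also have "\<dots> = herm (F z) w" by (simp add: h F_def herm_def algebra_simps)
    finally show ?thesis ..
  qed
  have "F (x + y) = F x + F y" for x y
    by (rule herm_nondegenerate_left) (simp add: F h herm_simps)
  moreover have "F (c *s x) = c *s F x" for c x
    by (rule herm_nondegenerate_left) (simp add: F h herm_simps)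
  moreover have "F (g *v x) = g *v F x" if g: "g \<in> G" for g x
  proof (rule herm_nondegenerate_left)
    fix w
    obtain k where "g *v (k *v w) = w" "herm (g *v F x) w = herm (F x) (k *v w)"
      using subgroup_SU21_inverse[OF G g] by metis
    then show "herm (F (g *v x)) w = herm (g *v F x) w"
      using inv[OF g, of x "k *v w"] by (simp add: F)
  qed
  ultimately obtain c where "\<And>x. F x = c *s x" using schur[OF tr] by blast
  then have "h x y = c * herm x y" for x y using F[of x y] by (simp add: herm_simps)
  then show thesis using that by blast
qed

text \<open>The kernel of J is stable under the complex span of G, so a nonzero kernel vector could
  be carried to \<open>x0\<close>.\<close>

lemma antilinear_intertwiner_inj:
  assumes tr: "transitive_on_vectors (cspan G)"
    and add: "\<And>x y. J (x + y) = J x + J y" and scale: "\<And>c x. J (c *s x) = cnj c *s J x"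
    and comm: "\<And>g x. g \<in> G \<Longrightarrow> J (g *v x) = g *v J x"
    and nz: "J x0 \<noteq> (0 :: complex^3)" and x: "J x = 0"
  shows "x = 0"
proof (rule ccontr)
  assume "x \<noteq> 0"
  then obtain S where "S \<in> cspan G" and S: "S *v x = x0"
    using tr unfolding transitive_on_vectors_def by blast
  then obtain X Y where XY: "S = X + mat \<i> ** Y" "X \<in> span G" "Y \<in> span G"
    unfolding cspan_def by blast
  have J0: "J 0 = 0" using scale[of 0 0] by simp
  have "J (Z *v x) = 0" if "Z \<in> span G" for Z
    using that
  proof (induction rule: span_induct)
    case base
    have "(k *\<^sub>R Z) *v x = complex_of_real k *s (Z *v x)" for k Z
      by (simp add: vec_eq_iff matrix_vector_mult_def sum_3 scaleR_conv_of_real[where 'a=complex] 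
          algebra_simps)
    then have "J ((k *\<^sub>R Z) *v x) = of_real k *s J (Z *v x)" for k Z
      by (metis scale complex_cnj_complex_of_real)
    then show ?case
      unfolding subspace_def by (simp add: J0 add matrix_vector_mult_add_rdistrib)
  qed (simp add: comm x)
  then have "J (S *v x) = 0"
    using XY by (simp add: matrix_vector_mult_add_rdistrib add scale mat_mult_mult_vec)
  then show False using S nz by simp
qed

text \<open>Writing \<open>J x = M *v cnj x\<close> (entrywise \<open>cnj\<close>), one has \<open>|det M|\<^sup>2 = l ^ 3\<close>. This excludes quaternionic
  structures (\<open>l < 0\<close>), as the dimension is odd.\<close>

lemma antilinear_square_nonneg:
  assumes add: "\<And>x y. J (x + y) = J x + J y" and scale: "\<And>c x. J (c *s x) = cnj c *s J x"
    and sq: "\<And>x. J (J x) = complex_of_real l *s (x :: complex^3)"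
  shows "l \<ge> 0"
proof -
  define M where "M = (\<chi> i j. J (axis j 1) $ i)"
  define M' where "M' = (\<chi> i j. cnj (M $ i $ j))"
  have J: "J x $ i = (\<Sum>j\<in>UNIV. M$i$j * cnj (x$j))" for x i
  proof -
    have "x = x$1 *s axis 1 1 + x$2 *s axis 2 1 + x$3 *s axis 3 1"
      by (simp add: vec_eq_iff forall_3 axis_def)
    then have "J x = J (x$1 *s axis 1 1 + x$2 *s axis 2 1 + x$3 *s axis 3 1)" by metis
    then show ?thesis by (simp add: add scale M_def sum_3 algebra_simps)
  qed
  have "(M ** M')$i$j = J (J (axis j 1)) $ i" for i j
    by (simp add: J[of "J (axis j 1)"] matrix_matrix_mult_def M'_def) (simp add: M_def)
  then have "M ** M' = mat (complex_of_real l)"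
    by (simp add: sq vec_eq_iff mat_def axis_def)
  then have "det M * det M' = det (mat (complex_of_real l) :: complex^3^3)"
    by (simp flip: det_mul)
  moreover have "det M' = cnj (det M)" by (simp add: det_3 M'_def)
  moreover have "det (mat (complex_of_real l) :: complex^3^3) = complex_of_real (l ^ 3)"
    by (simp add: det_3 mat_def power3_eq_cube)
  ultimately have "complex_of_real ((cmod (det M))\<^sup>2) = complex_of_real (l ^ 3)"
    by (simp only: complex_norm_square)
  then have "l ^ 3 = (cmod (det M))\<^sup>2" by (simp only: of_real_eq_iff)
  then have "l ^ 3 \<ge> 0" by simp
  then show ?thesis by (simp add: zero_le_power_eq)
qed

lemma irreducible_real_traces_real_structure:
  assumes G: "subgroup G SU21"
    and no_line: "\<And>v. v \<noteq> 0 \<Longrightarrow> \<exists>g\<in>G. \<forall>c. g *v v \<noteq> c *s v"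
    and real: "\<And>g. g \<in> G \<Longrightarrow> trace g \<in> \<real>"
  obtains J where "real_structure J" "\<And>g x. g \<in> G \<Longrightarrow> J (g *v x) = g *v J x"
proof -
  note mult = subgroup_SU21_mult[OF G] and one = subgroup_SU21_one[OF G]
  have tr: "transitive_on_vectors (cspan G)" by (rule irreducible_transitive[OF G no_line])
  have full: "cspan G = UNIV" by (rule burnside_3[OF matrix_algebra_cspan[OF one mult] tr])
  obtain J x0 where J: "\<And>x y. J (x + y) = J x + J y" "\<And>c x. J (c *s x) = cnj c *s J x"
      "\<And>g x. g \<in> G \<Longrightarrow> J (g *v x) = g *v J x" "J x0 \<noteq> (0 :: complex^3)"
    using antilinear_intertwiner[OF full mult one real] by blast
  have inj: "x = 0" if "J x = 0" for x
    using antilinear_intertwiner_inj[where J = J, OF tr J that] .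
  obtain l where l: "\<And>x. J (J x) = l *s x"
    using schur[OF tr, of "\<lambda>x. J (J x)"] J(1-3) by auto
  \<comment> \<open>Both sides are J applied three times to \<open>x0\<close>, grouped in two ways;
    this makes \<open>l\<close> real.\<close>
  have "l *s J x0 = cnj l *s J x0"
    using l[of "J x0"] l[of x0] J(2) by metis
  then have "cnj l = l" using J(4) by (metis vector_mul_rcancel)
  then obtain r where r: "l = complex_of_real r"
    by (metis Reals_cases Reals_cnj_iff)
  have "r \<noteq> 0"
  proof
    assume "r = 0"
    then have "J (J x0) = 0" by (simp add: l r)
    then show False using inj J(4) by blast
  qed
  moreover have "r \<ge> 0"
    by (rule antilinear_square_nonneg[of J]) (simp_all add: J l r)
  ultimately have "r > 0" by simp
  \<comment> \<open>Real \<open>k\<close> gives K^2 = k^2 J^2, so k^2 = 1/r normalizes the square to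
    1.\<close>
  define k where "k = complex_of_real (1 / sqrt r)"
  define K where "K x = k *s J x" for x
  have k: "cnj k = k" "k * k * l = 1"
    using \<open>r > 0\<close> by (simp_all add: k_def r flip: of_real_mult)
  have K: "K (x + y) = K x + K y" "K (c *s x) = cnj c *s K x" for x y c
    by (simp_all add: K_def J vector_add_ldistrib mult.commute)
  have KK: "K (K x) = x" for x
    using k by (simp add: K_def J l mult.assoc)
  have Kg: "K (g *v x) = g *v K x" if "g \<in> G" for g x
    by (simp add: K_def J that vec.scale)
  \<comment> \<open>The outer conjugation undoes the antilinearity of \<open>K\<close>, so that
    \<open>h\<close> is sesquilinear like \<open>herm\<close>.\<close>
  define h where "h x y = cnj (herm (K x) (K y))" for x y
  have inv: "h (g *v x) (g *v y) = h x y" if "g \<in> G" for g x y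
    using subgroup.mem_carrier[OF G that] by (simp add: h_def Kg that SU21_herm)
  have h: "h (x + y) z = h x z + h y z" "h (c *s x) z = c * h x z"
    "h z (x + y) = h z x + h z y" "h z (c *s x) = cnj c * h z x" for x y z c
    by (simp_all add: h_def K herm_simps)
  obtain c where c: "\<And>x y. h x y = c * herm x y"
    using invariant_sesquilinear_form_scalar[where h = h, OF G tr h inv] by blast
  \<comment> \<open>\<open>e\<close> and \<open>f\<close> are orthogonal positive vectors; a factor
    -1 would make their images orthogonal negative vectors, impossible in signature (2,1).\<close>
  define e where "e = (axis 2 1 :: complex^3)"
  define f where "f = (vector [1, 0, 1] :: complex^3)"
  have ef: "herm e e = 1" "herm f f = 2" "herm e f = 0"
    by (simp_all add: e_def f_def herm_def axis_def)
  have "c = cnj (herm (K e) (K e))" using c[of e e] by (simp add: h_def ef)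
  then have ce: "c = herm (K e) (K e)" by (metis herm_commute)
  \<comment> \<open>Since K^2 = 1, evaluating \<open>h\<close> at \<open>K e\<close> returns the
    norm of \<open>e\<close>, while \<open>c\<close> itself is the norm of
    \<open>K e\<close>.\<close>
  have "c * c = 1" using c[of "K e" "K e"] by (simp add: h_def KK ef flip: ce)
  moreover have "c \<noteq> - 1"
  proof
    assume m: "c = - 1"
    have "herm (K f) (K f) = - 2" using c[of f f] by (simp add: h_def ef m complex_eq_iff)
    moreover have "herm (K e) (K f) = 0" using c[of e f] by (simp add: h_def ef)
    moreover from \<open>herm (K f) (K f) = - 2\<close> have "K f \<noteq> 0" by auto
    moreover have "Re (herm (K e) (K e)) < 0" unfolding ce[symmetric] m by simp
    ultimately show False using perp_of_negative_is_positive[of "K e" "K f"] by simp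
  qed
  ultimately have "c = 1" using square_eq_1_iff by blast
  then have "herm (K x) (K y) = cnj (herm x y)" for x y
    using c[of x y] by (simp add: h_def) (metis complex_cnj_cnj)
  then have "real_structure K" unfolding real_structure_def using K KK by blast
  then show thesis using that Kg by blast
qed

section \<open>Invariant subspaces of the complex hyperbolic plane\<close>

lemma normalize_positive:
  assumes "Re (herm x x) > 0"
  obtains r :: real where "r \<noteq> 0" "herm (of_real r *s x) (of_real r *s x) = 1"
proof
  let ?r = "1 / sqrt (Re (herm x x))"
  show "?r \<noteq> 0" using assms by simp
  have "Re (herm (of_real ?r *s x) (of_real ?r *s x)) = 1"
    unfolding Re_herm_scale norm_of_real power2_abs using assms by (simp add: power_divide)
  then show "herm (of_real ?r *s x) (of_real ?r *s x) = 1"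
    by (subst herm_self) simp
qed

lemma normalize_negative:
  assumes "Re (herm x x) < 0"
  obtains r :: real where "r \<noteq> 0" "herm (of_real r *s x) (of_real r *s x) = - 1"
proof
  let ?r = "1 / sqrt (- Re (herm x x))"
  show "?r \<noteq> 0" using assms by simp
  have "Re (herm (of_real ?r *s x) (of_real ?r *s x)) = - 1"
    unfolding Re_herm_scale norm_of_real power2_abs using assms by (simp add: power_divide)
  then show "herm (of_real ?r *s x) (of_real ?r *s x) = - 1"
    by (subst herm_self) simp
qed

text \<open>With \<open>H\<close> the Gram matrix of the form and \<open>B'\<close> the conjugate
  transpose of B, isometry reads \<open>B' ** H ** B = H\<close>; take determinants.\<close>

lemma det_isometry:
  assumes "\<And>z w. herm (B *v z) (B *v w) = herm z w"
  shows "cmod (det B) = 1"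
proof -
  define H :: "complex^3^3" where "H = (\<chi> i j. herm (axis j 1) (axis i 1))"
  define B' where "B' = (\<chi> i j. cnj (B$j$i))"
  have B: "(B *v axis j 1)$i = B$i$j" for i j
    by (simp add: matrix_vector_mult_def axis_def if_distrib[of "(*) _"] cong: if_cong)
  have H: "H$1$1 = 0" "H$1$2 = 0" "H$1$3 = 1" "H$2$1 = 0" "H$2$2 = 1" "H$2$3 = 0"
    "H$3$1 = 1" "H$3$2 = 0" "H$3$3 = 0"
    by (simp_all add: H_def herm_def axis_def)
  have "(B' ** H ** B)$i$j = herm (B *v axis j 1) (B *v axis i 1)" for i j
    by (simp add: matrix_matrix_mult_def sum_3 B'_def H herm_def B)
  then have "B' ** H ** B = H" by (simp add: vec_eq_iff assms H_def)
  then have "det B' * det H * det B = det H" by (metis det_mul)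
  moreover have "det H = - 1" by (simp add: det_3 H)
  moreover have "det B' = cnj (det B)" by (simp add: det_3 B'_def)
  ultimately have "det B * cnj (det B) = 1" by (simp add: mult.commute)
  then have "complex_of_real ((cmod (det B))\<^sup>2) = 1" by (simp only: complex_norm_square)
  then have "(cmod (det B))\<^sup>2 = 1" by (metis of_real_eq_1_iff)
  then show ?thesis using norm_ge_zero[of "det B"] by (simp add: power2_eq_1_iff)
qed

text \<open>\<open>\<mu>\<close> is a cube root of 1 / \<open>det B\<close>. It has modulus 1, so
  multiplying by it corrects the determinant and preserves the form.\<close>

lemma isometry_rescale_SU21:
  assumes B: "\<And>z w. herm (B *v z) (B *v w) = herm z w"
  obtains \<mu> where "\<mu> \<noteq> 0" "mat \<mu> ** B \<in> carrier SU21"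
proof -
  have d: "cmod (det B) = 1" by (rule det_isometry[OF B])
  define \<mu> where "\<mu> = exp (Ln (1 / det B) / 3)"
  have "\<mu> ^ 3 = exp (3 * (Ln (1 / det B) / 3))"
    unfolding \<mu>_def exp_of_nat_mult[of 3, simplified] ..
  also have "\<dots> = 1 / det B"
    using d exp_Ln[of "1 / det B"] by fastforce
  finally have m3: "\<mu> ^ 3 = 1 / det B" .
  then have "cmod \<mu> ^ 3 = 1" using d by (simp flip: norm_power add: norm_divide)
  then have "cmod \<mu> = 1"
    using power_eq_iff_eq_base[of 3 "cmod \<mu>" 1] by simp
  then have mm: "\<mu> * cnj \<mu> = 1" using complex_norm_square[of \<mu>] by simp
  show thesis
  proof
    show "\<mu> \<noteq> 0" by (simp add: \<mu>_def)
    have "det (mat \<mu> ** B) = \<mu> ^ 3 * det B"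
      by (simp add: det_mul) (simp add: det_3 mat_def power3_eq_cube)
    then have "det (mat \<mu> ** B) = 1" using m3 d by auto
    moreover have "herm ((mat \<mu> ** B) *v z) ((mat \<mu> ** B) *v w) = herm z w" for z w
      using mm by (simp add: mat_mult_mult_vec herm_simps B mult.left_commute flip: mult.assoc)
    ultimately show "mat \<mu> ** B \<in> carrier SU21" by (simp add: SU21_def)
  qed
qed

lemma proj2_scale: "\<mu> \<noteq> 0 \<Longrightarrow> proj2 (\<mu> *s z) = proj2 z"
proof -
  assume m: "\<mu> \<noteq> 0"
  show ?thesis
  proof (cases "z = 0")
    case False
    then show ?thesis using m proj2_eq_iff[of z "\<mu> *s z"] by fastforce
  qed simp
qed

text \<open>The coordinates (z_1 + z_3)/sqrt 2 and (z_1 - z_3)/sqrt 2 diagonalize the hyperbolic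
  part of the form. \<open>A\<close> is a phase times \<open>B\<close> with the same projective
  action; \<open>B\<close> is kept because the phase may be nonreal and would spoil statements about
  fixed vectors.\<close>

lemma orthonormal_frame_isometry:
  assumes norms: "herm n n = - 1" "herm b b = 1" "herm v v = 1"
    and orth: "herm n b = 0" "herm n v = 0" "herm b v = 0"
  obtains A B where "A \<in> carrier SU21" "\<And>S. act A ` (proj2 ` S) = proj2 ` ((*v) B) ` S"
    "\<And>x. \<exists>z. B *v z = x" "\<And>z w. herm (B *v z) (B *v w) = herm z w"
    "\<And>z. B *v z = (z$1 + z$3) *s (of_real (1 / sqrt 2) *s b)
      + (z$1 - z$3) *s (of_real (1 / sqrt 2) *s n) + z$2 *s v"
proof -
  define s where "s = complex_of_real (1 / sqrt 2)"
  have s: "cnj s = s" "s * s = 1 / 2"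
    by (simp_all add: s_def flip: of_real_mult)
  define L where "L z = (z$1 + z$3) *s (s *s b) + (z$1 - z$3) *s (s *s n) + z$2 *s v" for z :: "complex^3"
  have "herm b n = 0" "herm v n = 0" "herm v b = 0"
    using orth herm_commute by (metis complex_cnj_zero)+
  then have hL: "herm (L z) (L w) = (z$1 + z$3) * cnj (w$1 + w$3) * (s * s)
      - (z$1 - z$3) * cnj (w$1 - w$3) * (s * s) + z$2 * cnj (w$2)" for z w
    by (simp add: L_def herm_simps orth norms s(1) algebra_simps)
  have iso: "herm (L z) (L w) = herm z w" for z w
    unfolding hL s(2) by (simp add: herm_def field_simps)
  define B where "B = matrix L"
  have "Vector_Spaces.linear (*s) (*s) L"
    by (simp add: Vector_Spaces.linear_iff vec.vector_space_axioms L_def)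
      (simp add: vec_eq_iff algebra_simps)
  then have B: "B *v z = L z" for z
    unfolding B_def by (rule matrix_works)
  have isoB: "herm (B *v z) (B *v w) = herm z w" for z w by (simp add: B iso)
  obtain \<mu> where m: "\<mu> \<noteq> 0" "mat \<mu> ** B \<in> carrier SU21"
    using isometry_rescale_SU21[OF isoB] .
  show thesis
  proof (rule that[OF m(2), of B])
    show "act (mat \<mu> ** B) ` (proj2 ` S) = proj2 ` ((*v) B) ` S" for S
      by (simp add: image_image act_proj2 mat_mult_mult_vec proj2_scale m(1))
    show "\<exists>z. B *v z = x" for x
    proof -
      have "det B \<noteq> 0" using det_isometry[OF isoB] by auto
      then have "invertible B" by (simp add: invertible_det_nz)
      then show ?thesis by (metis invertible_def matrix_vector_mul_assoc matrix_vector_mul_lid)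
    qed
  qed (rule isoB, simp add: B L_def s_def)
qed

lemma V_neg_third_nonzero: "r \<in> V_neg \<Longrightarrow> r$3 \<noteq> 0"
  using not_sum_squares_lt_zero[of "Re (r$2)" "Im (r$2)"] by (auto simp: V_neg_def herm_def)

lemma V_neg_proj2_affine: "r \<in> V_neg \<Longrightarrow> proj2 r = affine_pt (r$1 / r$3) (r$2 / r$3)"
proof -
  assume "r \<in> V_neg"
  then have r: "r$3 \<noteq> 0" by (rule V_neg_third_nonzero)
  then have "(1 / r$3) *s r = vector [r$1 / r$3, r$2 / r$3, 1]"
    by (simp add: vec_eq_iff forall_3)
  then show ?thesis using proj2_scale[of "1 / r$3" r] r by (simp add: affine_pt_def)
qed

lemma affine_pt_in_H2C_iff_V_neg: "affine_pt z1 z2 \<in> H2C \<longleftrightarrow> vector [z1, z2, 1] \<in> V_neg"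
  unfolding affine_pt_in_H2C_iff V_neg_def
  by (simp add: herm_def cmod_power2) (simp add: power2_eq_square)

text \<open>Homogeneous conditions replace affine coordinates, so that linear maps can transport the
  model.\<close>

lemma std_complex_line_eq: "std_complex_line = proj2 ` {r \<in> V_neg. r$2 = 0}"
proof (intro equalityI subsetI)
  fix p assume "p \<in> std_complex_line"
  then obtain z where "p = affine_pt z 0" "vector [z, 0, 1] \<in> V_neg"
    by (auto simp: std_complex_line_def affine_pt_in_H2C_iff_V_neg)
  then show "p \<in> proj2 ` {r \<in> V_neg. r$2 = 0}"
    by (auto simp: affine_pt_def intro!: imageI)
next
  fix p assume "p \<in> proj2 ` {r \<in> V_neg. r$2 = 0}"
  then obtain r where r: "r \<in> V_neg" "r$2 = 0" "p = proj2 r" by auto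
  then have "p = affine_pt (r$1 / r$3) 0" using V_neg_proj2_affine[of r] by simp
  moreover have "p \<in> H2C" using r by (simp add: H2C_def)
  ultimately show "p \<in> std_complex_line" by (auto simp: std_complex_line_def)
qed

lemma std_Lagrangian_plane_eq: "std_Lagrangian_plane = proj2 ` {r \<in> V_neg. \<forall>i. r$i \<in> \<real>}"
proof (intro equalityI subsetI)
  fix p assume "p \<in> std_Lagrangian_plane"
  then obtain z w where "p = affine_pt z w" "vector [z, w, 1] \<in> V_neg" "z \<in> \<real>" "w \<in> \<real>"
    by (auto simp: std_Lagrangian_plane_def affine_pt_in_H2C_iff_V_neg complex_is_Real_iff)
  then show "p \<in> proj2 ` {r \<in> V_neg. \<forall>i. r$i \<in> \<real>}"
    by (auto simp: affine_pt_def forall_3 intro!: imageI)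
next
  fix p assume "p \<in> proj2 ` {r \<in> V_neg. \<forall>i. r$i \<in> \<real>}"
  then obtain r where r: "r \<in> V_neg" "\<And>i. r$i \<in> \<real>" "p = proj2 r" by auto
  then have "p = affine_pt (r$1 / r$3) (r$2 / r$3)" using V_neg_proj2_affine[of r] by simp
  moreover have "r$1 / r$3 \<in> \<real>" "r$2 / r$3 \<in> \<real>" using r(2) by (auto intro: Reals_divide)
  moreover have "p \<in> H2C" using r by (simp add: H2C_def)
  ultimately show "p \<in> std_Lagrangian_plane"
    unfolding std_Lagrangian_plane_def complex_is_Real_iff by blast
qed

lemma herm_perp_of_two:
  obtains u where "u \<noteq> 0" "herm p u = 0" "herm q u = 0"
proof -
  have "vec.dim (vec.span {p, q}) \<le> card {p, q}"
    by (simp add: vec.dim_le_card')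
  also have "\<dots> < 3" by (simp add: card_insert_if)
  also have "3 = vec.dim (UNIV :: (complex^3) set)" by (simp only: vec_dim_card) simp
  finally have "vec.span {p, q} \<noteq> UNIV" by (metis less_irrefl)
  then show thesis
    using proper_subspace_herm_perp[of "vec.span {p, q}"] that vec.span_base[of _ "{p, q}"]
    by (metis insertCI vec.subspace_span)
qed

text \<open>Complete the normalized vector \<open>u\<close> to an orthonormal frame and use it as
  the image of the second basis vector; the second coordinate then becomes the pairing with
  \<open>u\<close>.\<close>

lemma complex_line_orthogonal_complement:
  assumes "Re (herm v v) > 0"
  shows "complex_line (proj2 ` {x \<in> V_neg. herm x v = 0})"
proof -
  obtain r where r: "r \<noteq> 0" "herm (of_real r *s v) (of_real r *s v) = 1"
    using normalize_positive[OF assms] .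
  define u where "u = complex_of_real r *s v"
  have u: "herm u u = 1" using r by (simp add: u_def)
  \<comment> \<open>\<open>e\<close> has norm -2, and removing its component along the positive unit
    vector \<open>u\<close> only lowers the norm.\<close>
  define e where "e = (vector [1, 0, - 1] :: complex^3)"
  define n' where "n' = e - herm e u *s u"
  have "herm n' n' = herm e e - herm e u * cnj (herm e u)"
    using herm_commute[of u e] by (simp add: n'_def herm_simps u algebra_simps)
  moreover have "herm e e = - 2" by (simp add: e_def herm_def)
  ultimately have "herm n' n' = complex_of_real (- 2 - (cmod (herm e u))\<^sup>2)"
    by (simp add: complex_norm_square del: of_real_power)
  then have "Re (herm n' n') = - 2 - (cmod (herm e u))\<^sup>2"
    by (simp only: Re_complex_of_real)
  then have "Re (herm n' n') < 0" using zero_le_power2[of "cmod (herm e u)"] by linarith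
  then obtain t where t: "herm (of_real t *s n') (of_real t *s n') = - 1"
    using normalize_negative by blast
  define n where "n = complex_of_real t *s n'"
  have n: "herm n n = - 1" "herm n u = 0"
    using t by (simp_all add: n_def n'_def herm_simps u)
  obtain b' where b': "b' \<noteq> 0" "herm n b' = 0" "herm u b' = 0"
    using herm_perp_of_two by blast
  have "Re (herm b' b') > 0" using perp_of_negative_is_positive[of n b'] n b' by simp
  then obtain k where k: "herm (of_real k *s b') (of_real k *s b') = 1"
    using normalize_positive by blast
  define b where "b = complex_of_real k *s b'"
  have b: "herm b b = 1" "herm n b = 0" "herm b u = 0"
    using k b' herm_commute[of b' u] by (simp_all add: b_def herm_simps)
  obtain A B where A: "A \<in> carrier SU21" "\<And>S. act A ` (proj2 ` S) = proj2 ` ((*v) B) ` S"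
    and surj: "\<And>x. \<exists>z. B *v z = x" and iso: "\<And>z w. herm (B *v z) (B *v w) = herm z w"
    and B: "\<And>z. B *v z = (z$1 + z$3) *s (of_real (1 / sqrt 2) *s b)
      + (z$1 - z$3) *s (of_real (1 / sqrt 2) *s n) + z$2 *s u"
    by (rule orthonormal_frame_isometry[OF n(1) b(1) u b(2) n(2) b(3)]) (rule that)
  have Bu: "herm (B *v z) u = z$2" for z by (simp add: B herm_simps b n u)
  have Bv: "herm (B *v z) v = 0 \<longleftrightarrow> z$2 = 0" for z
  proof -
    have "of_real r * herm (B *v z) v = z$2" using Bu[of z] by (simp add: u_def herm_simps)
    then show ?thesis using r(1) by (metis mult_eq_0_iff of_real_eq_0_iff)
  qed
  have "((*v) B) ` {r \<in> V_neg. r$2 = 0} = {x \<in> V_neg. herm x v = 0}"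
  proof (intro equalityI subsetI)
    fix x assume "x \<in> {x \<in> V_neg. herm x v = 0}"
    moreover obtain z where "B *v z = x" using surj by blast
    ultimately show "x \<in> ((*v) B) ` {r \<in> V_neg. r$2 = 0}"
      using iso Bv[of z] by (auto simp: V_neg_def intro!: image_eqI[of _ _ z])
  qed (use iso Bv in \<open>auto simp: V_neg_def\<close>)
  then have "proj2 ` {x \<in> V_neg. herm x v = 0} = act A ` std_complex_line"
    unfolding std_complex_line_eq A(2) by simp
  then show ?thesis unfolding complex_line_def using A(1) by blast
qed

text \<open>J conjugates pairings, so it preserves orthogonality to fixed vectors. Thus u + J u is a
  fixed solution, unless J u = -u, when \<open>\<i> *s u\<close> is fixed.\<close>

lemma real_structure_fixed_perp:
  assumes J: "real_structure J" and pq: "J p = p" "J q = q"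
  obtains b where "b \<noteq> 0" "J b = b" "herm p b = 0" "herm q b = 0"
proof -
  have J': "J (x + y) = J x + J y" "J (c *s x) = cnj c *s J x" "J (J x) = x"
    "herm (J x) (J y) = cnj (herm x y)" for x y c
    using J by (simp_all add: real_structure_def)
  obtain u where u: "u \<noteq> 0" "herm p u = 0" "herm q u = 0" using herm_perp_of_two by blast
  have Ju: "herm p (J u) = 0" "herm q (J u) = 0"
    using J'(4)[of p u] J'(4)[of q u] by (simp_all add: pq u)
  show thesis
  proof (cases "u + J u = 0")
    case True
    then have "J u = - u" by (simp add: eq_neg_iff_add_eq_0 add.commute)
    then have "J (\<i> *s u) = \<i> *s u" by (simp add: J' vec_eq_iff)
    then show thesis using that[of "\<i> *s u"] u by (simp add: herm_simps)
  next
    case False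
    then show thesis using that[of "u + J u"] u Ju by (simp add: J' herm_simps add.commute)
  qed
qed

text \<open>\<open>x\<close> and \<open>y\<close> are twice the real and imaginary parts of
  \<open>e\<close> up to sign. In the sum of their norms the cross terms cancel, leaving twice the
  norms of \<open>e\<close> and \<open>J e\<close>, so one of them is negative.\<close>

lemma real_structure_fixed_negative:
  assumes J: "real_structure J"
  obtains n where "J n = n" "Re (herm n n) < 0"
proof -
  have J': "J (x + y) = J x + J y" "J (c *s x) = cnj c *s J x" "J (J x) = x"
    "herm (J x) (J y) = cnj (herm x y)" for x y c
    using J by (simp_all add: real_structure_def)
  define e where "e = (vector [1, 0, - 1] :: complex^3)"
  define x y where "x = e + J e" and "y = \<i> *s (e + (- 1) *s J e)"
  have Jx: "J x = x" by (simp add: x_def J' add.commute)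
  have Jy: "J y = y" unfolding y_def J' by (simp add: vec_eq_iff)
  have ee: "herm e e = - 2" by (simp add: e_def herm_def)
  have "herm (J e) (J e) = - 2" by (simp add: J' ee)
  then have "herm x x + herm y y = - 8"
    by (simp add: x_def y_def herm_simps ee algebra_simps)
  then have "Re (herm x x) + Re (herm y y) = - 8"
    by (metis plus_complex.sel(1) Re_complex_of_real of_real_neg_numeral)
  then have "Re (herm x x) < 0 \<or> Re (herm y y) < 0" by linarith
  then show thesis using that Jx Jy by blast
qed

text \<open>For an orthonormal frame of fixed vectors, \<open>B\<close> carries coordinatewise
  conjugation to J, hence real coordinate vectors to fixed vectors.\<close>

lemma Lagrangian_plane_fixed_points:
  assumes J: "real_structure J"
  shows "Lagrangian_plane (proj2 ` {x \<in> V_neg. J x = x})"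
proof -
  have J': "J (x + y) = J x + J y" "J (c *s x) = cnj c *s J x" "J (J x) = x"
    "herm (J x) (J y) = cnj (herm x y)" for x y c
    using J by (simp_all add: real_structure_def)
  obtain n' where n': "J n' = n'" "Re (herm n' n') < 0"
    using real_structure_fixed_negative[OF J] .
  obtain t where t: "herm (of_real t *s n') (of_real t *s n') = - 1"
    using normalize_negative[OF n'(2)] by blast
  define n where "n = complex_of_real t *s n'"
  have n: "J n = n" "herm n n = - 1" using n' t by (simp_all add: n_def J')
  \<comment> \<open>Only orthogonality to \<open>n\<close> is wanted, so \<open>n\<close> fills both
    slots.\<close>
  obtain b' where b': "b' \<noteq> 0" "J b' = b'" "herm n b' = 0"
    using real_structure_fixed_perp[OF J n(1) n(1)] by blast
  then have "Re (herm b' b') > 0" using perp_of_negative_is_positive[of n b'] n by simp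
  then obtain k where k: "herm (of_real k *s b') (of_real k *s b') = 1"
    using normalize_positive by blast
  define b where "b = complex_of_real k *s b'"
  have b: "J b = b" "herm b b = 1" "herm n b = 0"
    using k b' by (simp_all add: b_def J' herm_simps)
  obtain v' where v': "v' \<noteq> 0" "J v' = v'" "herm n v' = 0" "herm b v' = 0"
    using real_structure_fixed_perp[OF J n(1) b(1)] by blast
  then have "Re (herm v' v') > 0" using perp_of_negative_is_positive[of n v'] n by simp
  then obtain l where l: "herm (of_real l *s v') (of_real l *s v') = 1"
    using normalize_positive by blast
  define v where "v = complex_of_real l *s v'"
  have v: "J v = v" "herm v v = 1" "herm n v = 0" "herm b v = 0"
    using l v' by (simp_all add: v_def J' herm_simps)
  obtain A B where A: "A \<in> carrier SU21" "\<And>S. act A ` (proj2 ` S) = proj2 ` ((*v) B) ` S"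
    and surj: "\<And>x. \<exists>z. B *v z = x" and iso: "\<And>z w. herm (B *v z) (B *v w) = herm z w"
    and B: "\<And>z. B *v z = (z$1 + z$3) *s (of_real (1 / sqrt 2) *s b)
      + (z$1 - z$3) *s (of_real (1 / sqrt 2) *s n) + z$2 *s v"
    by (rule orthonormal_frame_isometry[OF n(2) b(2) v(2) b(3) v(3,4)]) (rule that)
  have inj: "z = w" if eq: "B *v z = B *v w" for z w
    using iso[of z] iso[of w] by (intro herm_nondegenerate_left) (simp add: eq)
  have JB: "J (B *v z) = B *v (\<chi> i. cnj (z$i))" for z
    by (simp add: B J' n b v)
  have fixed: "J (B *v z) = B *v z \<longleftrightarrow> (\<forall>i. z$i \<in> \<real>)" for z
  proof -
    have "J (B *v z) = B *v z \<longleftrightarrow> (\<chi> i. cnj (z$i)) = z"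
      unfolding JB by (rule iffI, erule inj, erule arg_cong)
    then show ?thesis by (simp add: Reals_cnj_iff vec_eq_iff)
  qed
  have "((*v) B) ` {r \<in> V_neg. \<forall>i. r$i \<in> \<real>} = {x \<in> V_neg. J x = x}"
  proof (intro equalityI subsetI)
    fix x assume "x \<in> {x \<in> V_neg. J x = x}"
    moreover obtain z where "B *v z = x" using surj by blast
    ultimately show "x \<in> ((*v) B) ` {r \<in> V_neg. \<forall>i. r$i \<in> \<real>}"
      using iso fixed[of z] by (auto simp: V_neg_def intro!: image_eqI[of _ _ z])
  qed (use iso fixed in \<open>auto simp: V_neg_def\<close>)
  then have "proj2 ` {x \<in> V_neg. J x = x} = act A ` std_Lagrangian_plane"
    unfolding std_Lagrangian_plane_eq A(2) by simp
  then show ?thesis unfolding Lagrangian_plane_def using A(1) by blast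
qed

text \<open>Stability of P in one direction is enough: applied to the inverse, it gives the reverse
  inclusion.\<close>

lemma keeps_invariant_proj2:
  assumes G: "subgroup G SU21" and P: "\<And>g x. g \<in> G \<Longrightarrow> P x \<Longrightarrow> P (g *v x)"
  shows "keeps_invariant G (proj2 ` {x \<in> V_neg. P x})"
  unfolding keeps_invariant_def
proof
  fix g assume g: "g \<in> G"
  obtain h where h: "h \<in> G" "\<And>x. g *v (h *v x) = x"
    using subgroup_SU21_inverse[OF G g] by metis
  have V: "k *v x \<in> V_neg" if "k \<in> G" "x \<in> V_neg" for k x
    using SU21_herm[OF subgroup.mem_carrier[OF G that(1)]] that(2) by (simp add: V_neg_def)
  have "(*v) g ` {x \<in> V_neg. P x} = {x \<in> V_neg. P x}"
  proof (intro equalityI subsetI)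
    fix x assume "x \<in> {x \<in> V_neg. P x}"
    then have "h *v x \<in> {x \<in> V_neg. P x}" using V h(1) P by blast
    then show "x \<in> (*v) g ` {x \<in> V_neg. P x}" by (metis h(2) imageI)
  qed (use V g P in blast)
  then show "act g ` proj2 ` {x \<in> V_neg. P x} = proj2 ` {x \<in> V_neg. P x}"
    by (metis (no_types, lifting) act_proj2 image_cong image_image)
qed

theorem theorem2:
  fixes G :: "(complex^3^3) set"
  assumes "complex_kleinian G"
    and "\<not> elementary G"
    and "\<And>g. g \<in> G \<Longrightarrow> trace g \<in> \<real>"
  shows "Fuchsian G"
proof (cases "\<exists>v. v \<noteq> 0 \<and> (\<forall>g\<in>G. \<exists>c. g *v v = c *s v)")
  case True
  have G: "subgroup G SU21" using assms(1) by (simp add: complex_kleinian_def)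
  obtain v where v: "v \<noteq> 0" "\<And>g. g \<in> G \<Longrightarrow> \<exists>c. g *v v = c *s v" using True by blast
  have "Re (herm v v) > 0"
  proof (rule ccontr)
    assume "\<not> Re (herm v v) > 0"
    then have "v \<in> V_neg \<or> v \<in> V_null - {0}"
      using v(1) herm_self[of v] by (auto simp: V_neg_def V_null_def complex_eq_iff)
    then have "proj2 v \<in> closed_H2C" by (auto simp: closed_H2C_def H2C_def bdry_H2C_def)
    moreover have "act g (proj2 v) = proj2 v" if g: "g \<in> G" for g
    proof -
      obtain c where c: "g *v v = c *s v" using v(2)[OF g] by blast
      moreover have "c \<noteq> 0"
        using subgroup_SU21_inverse[OF G g] c v(1)
        by (metis matrix_vector_mult_0_right vector_smult_lzero)
      ultimately show ?thesis by (simp add: act_proj2 proj2_scale)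
    qed
    then have "(\<lambda>g. act g (proj2 v)) ` G \<subseteq> {proj2 v}" by blast
    then have "finite ((\<lambda>g. act g (proj2 v)) ` G)" by (rule finite_subset) simp
    ultimately show False using assms(2) unfolding elementary_def by blast
  qed
  then have "complex_line (proj2 ` {x \<in> V_neg. herm x v = 0})"
    by (rule complex_line_orthogonal_complement)
  moreover have "keeps_invariant G (proj2 ` {x \<in> V_neg. herm x v = 0})"
  proof (rule keeps_invariant_proj2[OF G])
    \<comment> \<open>Moving g across the form turns it into its inverse, which only rescales
      v.\<close>
    fix g x assume g: "g \<in> G" and x: "herm x v = 0"
    obtain h where h: "h \<in> G" "herm (g *v x) v = herm x (h *v v)"
      using subgroup_SU21_inverse[OF G g] by metis
    then show "herm (g *v x) v = 0" using v(2)[OF h(1)] x by (auto simp: herm_simps)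
  qed
  ultimately show ?thesis
    using assms(1) unfolding Fuchsian_def C_Fuchsian_def by blast
next
  case False
  have G: "subgroup G SU21" using assms(1) by (simp add: complex_kleinian_def)
  obtain J where J: "real_structure J" "\<And>g x. g \<in> G \<Longrightarrow> J (g *v x) = g *v J x"
    using irreducible_real_traces_real_structure[OF G _ assms(3)] False by blast
  have "keeps_invariant G (proj2 ` {x \<in> V_neg. J x = x})"
    by (rule keeps_invariant_proj2[OF G]) (simp add: J(2))
  then show ?thesis
    using Lagrangian_plane_fixed_points[OF J(1)] assms(1)
    unfolding Fuchsian_def R_Fuchsian_def by blast
qed

end
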